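(* Let $G$ be a finite simple graph without isolated vertices, let $H$ be an induced subgraph of $G$, and let $n$ be a positive integer. Let $m$ be the product of all vertices of $H$. Then \[\big(I(G)^{(n)}\big)^{\leq m^n}=I(H)^{(n)}.\] In particular, if $I(G)^{(n)}$ is Scarf, then so is $I(H)^{(n)}$.
   Context: Let $\Bbbk$ be a field and $S=\Bbbk[V(G)]$ the polynomial ring whose variables are the vertices of $G$; ideals attached to $H$ are regarded as ideals of $S$. The edge ideal of a graph $K$ is $I(K)=(xy : \{x,y\}\in E(K))$. Let $\mathcal C(K)$ be the set of minimal vertex covers of $K$ and let $\mathfrak p_A$ be the prime ideal generated by the variables in $A$. The $n$-th symbolic power is $I(K)^{(n)}=\bigcap_{A\in\mathcal C(K)}\mathfrak p_A^n$. For a monomial ideal $I$ and a monomial $u$, $I^{\leq u}$ denotes the ideal generated by all minimal monomial generators of $I$ that divide $u$. Scarf ideals: for a monomial ideal $I$ let $\operatorname{Mingens}(I)$ be its set of minimal monomial generators. The Taylor resolution of $S/I$ has free basis $e_\sigma$, $\sigma\subseteq\operatorname{Mingens}(I)$, with $e_\sigma$ in homological degree $|\sigma|$ and $\partial(e_\sigma)=\sum_{j=1}^t(-1)^{j+1}\frac{\operatorname{lcm}(\sigma)}{\operatorname{lcm}(\sigma\setminus\{m_{i_j}\})}e_{\sigma\setminus\{m_{i_j}\}}$ for $\sigma=\{m_{i_1},\dots,m_{i_t}\}$. The Scarf complex of $I$ is the simplicial complex of all $\sigma\subseteq\operatorname{Mingens}(I)$ such that $\operatorname{lcm}(\sigma)\neq\operatorname{lcm}(\tau)$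 for every $\tau\subseteq\operatorname{Mingens}(I)$ with $\tau\neq\sigma$. It induces a subcomplex of the Taylor resolution (spanned by the $e_\sigma$ with $\sigma$ in the Scarf complex). $I$ is called Scarf if this subcomplex is a minimal free resolution of $S/I$ (equivalently, a free resolution of $S/I$). *)

theory Defs
  imports "HOL-Library.Poly_Mapping" "HOL-Library.Multiset" "HOL-Algebra.Ideal_Product"
begin

section \<open>Graphs\<close>

record 'v graph =
  verts :: "'v set"
  edges :: "'v set set"

definition finite_simple_graph :: "'v graph \<Rightarrow> bool" where
  "finite_simple_graph G \<longleftrightarrow>
     finite (verts G) \<and> (\<forall>e\<in>edges G. e \<subseteq> verts G \<and> card e = 2)"

definition no_isolated_vertices :: "'v graph \<Rightarrow> bool" where
  "no_isolated_vertices G \<longleftrightarrow> (\<forall>v\<in>verts G. \<exists>e\<in>edges G. v \<in> e)"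

definition induced_subgraph_of :: "'v graph \<Rightarrow> 'v graph \<Rightarrow> bool" where
  "induced_subgraph_of H G \<longleftrightarrow>
     verts H \<subseteq> verts G \<and> edges H = {e \<in> edges G. e \<subseteq> verts H}"

definition vertex_cover :: "'v graph \<Rightarrow> 'v set \<Rightarrow> bool" where
  "vertex_cover K A \<longleftrightarrow> A \<subseteq> verts K \<and> (\<forall>e\<in>edges K. e \<inter> A \<noteq> {})"

definition minimal_vertex_covers :: "'v graph \<Rightarrow> 'v set set" where
  "minimal_vertex_covers K = {A. vertex_cover K A \<and> (\<forall>B. B \<subset> A \<longrightarrow> \<not> vertex_cover K B)}"


section \<open>The polynomial ring\<close>

text \<open>
  A monomial is a finite multiset of variables: the empty multiset is the monomial 1, the sum of
  multisets is the product of monomials, \<open>\<subseteq>#\<close> is divisibility, difference is the quotient by a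
  divisor, and \<open>Sup\<close> of a finite set of multisets is the least common multiple (with
  \<open>Sup {} = {#}\<close>).  Polynomials are finitely supported functions from monomials to the field, with
  the convolution product of \<^theory>\<open>HOL-Library.Poly_Mapping\<close>.
\<close>

type_synonym ('v, 'k) polynomial = "'v multiset \<Rightarrow>\<^sub>0 'k"

definition monomial :: "'v multiset \<Rightarrow> ('v, 'k::field) polynomial" where
  "monomial u = Poly_Mapping.single u 1"

definition var :: "'v \<Rightarrow> ('v, 'k::field) polynomial" where
  "var x = monomial {#x#}"

definition poly_ring :: "'v set \<Rightarrow> ('v, 'k::field) polynomial ring" where
  "poly_ring V = \<lparr>carrier = {p. \<forall>u\<in>Poly_Mapping.keys p. set_mset u \<subseteq> V},
     mult = (*), one = 1, zero = 0, add = (+)\<rparr>"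


section \<open>Symbolic powers of edge ideals\<close>

definition var_ideal :: "'v set \<Rightarrow> 'v set \<Rightarrow> ('v, 'k::field) polynomial set" where
  "var_ideal V A = genideal (poly_ring V) (var ` A)"

definition ideal_power :: "'v set \<Rightarrow> ('v, 'k::field) polynomial set \<Rightarrow> nat \<Rightarrow> ('v, 'k) polynomial set" where
  "ideal_power V J n = (ideal_prod (poly_ring V) J ^^ n) (carrier (poly_ring V))"

text \<open>
  The symbolic power of the edge ideal of \<open>K\<close>, as an ideal of the polynomial ring in the variables
  \<open>V\<close>, where \<open>V\<close> may be larger than the vertex set of \<open>K\<close>.
\<close>

definition edge_ideal_symbolic_power :: "'v set \<Rightarrow> 'v graph \<Rightarrow> nat \<Rightarrow> ('v, 'k::field) polynomial set" where
  "edge_ideal_symbolic_power V K n = (\<Inter>A\<in>minimal_vertex_covers K. ideal_power V (var_ideal V A) n)"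


section \<open>Minimal monomial generators\<close>

definition minimal_monomial_generating_set ::
    "'v set \<Rightarrow> ('v, 'k::field) polynomial set \<Rightarrow> 'v multiset set \<Rightarrow> bool" where
  "minimal_monomial_generating_set V I M \<longleftrightarrow>
     (\<forall>u\<in>M. set_mset u \<subseteq> V) \<and> genideal (poly_ring V) (monomial ` M) = I \<and>
     (\<forall>N. N \<subset> M \<longrightarrow> genideal (poly_ring V) (monomial ` N) \<noteq> I)"

text \<open>
  Every monomial ideal has exactly one minimal generating set of monomials; that there is at most one
  is proved below (\<open>minimal_monomial_generating_set_unique\<close>).
\<close>

definition mingens :: "'v set \<Rightarrow> ('v, 'k::field) polynomial set \<Rightarrow> 'v multiset set" where
  "mingens V I = (THE M. minimal_monomial_generating_set V I M)"

definition restrict_below ::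
    "'v set \<Rightarrow> ('v, 'k::field) polynomial set \<Rightarrow> 'v multiset \<Rightarrow> ('v, 'k) polynomial set" where
  "restrict_below V I u = genideal (poly_ring V) (monomial ` {w \<in> mingens V I. w \<subseteq># u})"


section \<open>The Taylor resolution and Scarf ideals\<close>

text \<open>
  A chain is a finitely supported family of coefficients, indexed by the sets of monomials \<open>\<sigma>\<close>;
  \<open>Poly_Mapping.single \<sigma> p\<close> is \<open>p\<close> times the basis element belonging to \<open>\<sigma>\<close>.
\<close>

type_synonym ('v, 'k) chain = "'v multiset set \<Rightarrow>\<^sub>0 ('v, 'k) polynomial"

text \<open>
  The injection \<open>idx\<close> numbers the minimal generators.  If \<open>m\<close> is the \<open>j\<close>-th element of \<open>\<sigma>\<close> in this
  numbering, then the cardinality in the exponent of the sign is \<open>j - 1\<close>.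
\<close>

definition taylor_differential :: "('v multiset \<Rightarrow> nat) \<Rightarrow> ('v, 'k::field) chain \<Rightarrow> ('v, 'k) chain" where
  "taylor_differential idx c =
     (\<Sum>\<sigma>\<in>Poly_Mapping.keys c. \<Sum>m\<in>\<sigma>.
        Poly_Mapping.single (\<sigma> - {m})
          (Poly_Mapping.lookup c \<sigma> * (- 1) ^ card {m' \<in> \<sigma>. idx m' < idx m} *
             monomial (Sup \<sigma> - Sup (\<sigma> - {m}))))"

definition scarf_complex :: "'v set \<Rightarrow> ('v, 'k::field) polynomial set \<Rightarrow> 'v multiset set set" where
  "scarf_complex V I =
     {\<sigma>. \<sigma> \<subseteq> mingens V I \<and> (\<forall>\<tau>. \<tau> \<subseteq> mingens V I \<and> \<tau> \<noteq> \<sigma> \<longrightarrow> Sup \<sigma> \<noteq> Sup \<tau>)}"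

definition scarf_chains :: "'v set \<Rightarrow> ('v, 'k::field) polynomial set \<Rightarrow> nat \<Rightarrow> ('v, 'k) chain set" where
  "scarf_chains V I d =
     {c. Poly_Mapping.keys c \<subseteq> {\<sigma> \<in> scarf_complex V I. card \<sigma> = d} \<and>
         (\<forall>\<sigma>. Poly_Mapping.lookup c \<sigma> \<in> carrier (poly_ring V))}"

text \<open>
  The free module in homological degree 0 has basis \<open>{} \<in> scarf_complex V I\<close> (or is 0 if \<open>I\<close> is the
  unit ideal), and its augmentation to \<open>S/I\<close> sends a chain to the class of its coefficient at \<open>{}\<close>.
  The five conditions say that the Scarf modules form a subcomplex, that the augmentation is onto,
  exactness in degree 0, exactness in positive degrees, and minimality: the differential has image
  in the homogeneous maximal ideal times the next module.
\<close>

definition scarf_is_minimal_free_resolution ::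
    "('v multiset \<Rightarrow> nat) \<Rightarrow> 'v set \<Rightarrow> ('v, 'k::field) polynomial set \<Rightarrow> bool" where
  "scarf_is_minimal_free_resolution idx V I \<longleftrightarrow>
     (let F = scarf_chains V I; D = taylor_differential idx in
        (\<forall>d. D ` F (Suc d) \<subseteq> F d) \<and>
        (\<forall>p\<in>carrier (poly_ring V). \<exists>c\<in>F 0. p - Poly_Mapping.lookup c {} \<in> I) \<and>
        D ` F 1 = {c \<in> F 0. Poly_Mapping.lookup c {} \<in> I} \<and>
        (\<forall>d\<ge>1. D ` F (Suc d) = {c \<in> F d. D c = 0}) \<and>
        (\<forall>d. \<forall>c\<in>F (Suc d). \<forall>\<tau>. Poly_Mapping.lookup (D c) \<tau> \<in> var_ideal V V))"

text \<open>
  Another numbering changes the basis elements of the Taylor resolution by signs only, so the choice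
  of \<open>idx\<close> does not matter; one exists because \<open>mingens V I\<close> is finite for finite \<open>V\<close>.
\<close>

definition is_Scarf :: "'v set \<Rightarrow> ('v, 'k::field) polynomial set \<Rightarrow> bool" where
  "is_Scarf V I \<longleftrightarrow>
     (\<exists>idx. inj_on idx (mingens V I) \<and> scarf_is_minimal_free_resolution idx V I)"


section \<open>Well-definedness\<close>

lemma keys_uminus_poly: "Poly_Mapping.keys (- p) = Poly_Mapping.keys (p :: ('v, 'k::field) polynomial)"
  by (auto simp: in_keys_iff)

lemma cring_poly_ring: "cring (poly_ring V :: ('v, 'k::field) polynomial ring)"
proof (rule cringI)
  show "abelian_group (poly_ring V :: ('v, 'k) polynomial ring)"
  proof (rule abelian_groupI)
    fix x assume x: "x \<in> carrier (poly_ring V :: ('v, 'k) polynomial ring)"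
    show "\<exists>y\<in>carrier (poly_ring V). y \<oplus>\<^bsub>poly_ring V\<^esub> x = \<zero>\<^bsub>poly_ring V\<^esub>"
      using x by (intro bexI[of _ "- x"]) (auto simp: poly_ring_def keys_uminus_poly)
  qed (use Poly_Mapping.keys_add in \<open>fastforce simp: poly_ring_def algebra_simps\<close>)+
  show "comm_monoid (poly_ring V :: ('v, 'k) polynomial ring)"
  proof (rule comm_monoidI)
    fix x y assume "x \<in> carrier (poly_ring V :: ('v, 'k) polynomial ring)"
      "y \<in> carrier (poly_ring V :: ('v, 'k) polynomial ring)"
    then show "x \<otimes>\<^bsub>poly_ring V\<^esub> y \<in> carrier (poly_ring V)"
      using keys_mult[of x y] by (fastforce simp: poly_ring_def)
  qed (auto simp: poly_ring_def algebra_simps)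
qed (auto simp: poly_ring_def algebra_simps)

lemma monomial_in_genideal_imp:
  assumes M: "\<forall>u\<in>M. set_mset u \<subseteq> V"
    and w: "(monomial w :: ('v, 'k::field) polynomial) \<in> genideal (poly_ring V) (monomial ` M)"
  shows "\<exists>u\<in>M. u \<subseteq># w"
proof -
  interpret R: cring "poly_ring V :: ('v, 'k) polynomial ring" by (rule cring_poly_ring)
  define J where "J = {p \<in> carrier (poly_ring V :: ('v, 'k) polynomial ring).
                         \<forall>w\<in>Poly_Mapping.keys p. \<exists>u\<in>M. u \<subseteq># w}"
  have minus: "\<ominus>\<^bsub>poly_ring V\<^esub> p = - p" if "p \<in> carrier (poly_ring V :: ('v, 'k) polynomial ring)" for p
    by (rule sym, rule R.sum_zero_eq_neg) (use that in \<open>auto simp: poly_ring_def keys_uminus_poly\<close>)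
  have mult: "x * a \<in> J" if "a \<in> J" "x \<in> carrier (poly_ring V)" for a x
  proof -
    have "x * a \<in> carrier (poly_ring V)"
      using R.m_closed[of x a] that by (auto simp: J_def poly_ring_def)
    moreover have "\<exists>u\<in>M. u \<subseteq># w" if w: "w \<in> Poly_Mapping.keys (x * a)" for w
    proof -
      obtain s t where "w = s + t" "t \<in> Poly_Mapping.keys a"
        using w keys_mult[of x a] by blast
      then show ?thesis using \<open>a \<in> J\<close>
        by (auto simp: J_def) (metis mset_subset_eq_add_right subset_mset.order_trans)
    qed
    ultimately show ?thesis by (simp add: J_def)
  qed
  have "ideal J (poly_ring V)"
  proof (rule idealI)
    show "ring (poly_ring V :: ('v, 'k) polynomial ring)" by (rule R.ring_axioms)
    show "subgroup J (add_monoid (poly_ring V))"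
    proof (rule group.subgroupI)
      show "group (add_monoid (poly_ring V :: ('v, 'k) polynomial ring))" by (rule R.a_group)
      show "J \<noteq> {}" by (auto simp: J_def poly_ring_def intro!: exI[of _ 0])
      show "inv\<^bsub>add_monoid (poly_ring V)\<^esub> a \<in> J" if "a \<in> J" for a
        using minus[of a] that unfolding a_inv_def
        by (auto simp: J_def poly_ring_def keys_uminus_poly)
      show "a \<otimes>\<^bsub>add_monoid (poly_ring V)\<^esub> b \<in> J" if "a \<in> J" "b \<in> J" for a b
        using that Poly_Mapping.keys_add[of a b] by (fastforce simp: J_def poly_ring_def)
    qed (auto simp: J_def)
    fix a x assume "a \<in> J" "x \<in> carrier (poly_ring V :: ('v, 'k) polynomial ring)"
    then show "x \<otimes>\<^bsub>poly_ring V\<^esub> a \<in> J" "a \<otimes>\<^bsub>poly_ring V\<^esub> x \<in> J"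
      using mult[of a x] by (auto simp: poly_ring_def mult.commute)
  qed
  moreover have "monomial ` M \<subseteq> J"
    using M by (auto simp: J_def poly_ring_def monomial_def)
  ultimately have "genideal (poly_ring V) (monomial ` M) \<subseteq> J"
    by (rule R.genideal_minimal)
  then show ?thesis using w by (auto simp: J_def monomial_def)
qed

lemma minimal_monomial_generating_set_unique:
  fixes I :: "('v, 'k::field) polynomial set"
  assumes "minimal_monomial_generating_set V I M" "minimal_monomial_generating_set V I N"
  shows "M = N"
proof -
  interpret R: cring "poly_ring V :: ('v, 'k) polynomial ring" by (rule cring_poly_ring)
  have sub: "M \<subseteq> N"
    if M: "minimal_monomial_generating_set V I M" and N: "minimal_monomial_generating_set V I N"
    for M N :: "'v multiset set"
  proof
    fix m assume m: "m \<in> M"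
    have MV: "\<forall>u\<in>M. set_mset u \<subseteq> V" "\<forall>u\<in>N. set_mset u \<subseteq> V"
      using M N by (simp_all add: minimal_monomial_generating_set_def)
    have car: "monomial ` M \<subseteq> carrier (poly_ring V :: ('v, 'k) polynomial ring)"
      "monomial ` N \<subseteq> carrier (poly_ring V :: ('v, 'k) polynomial ring)"
      using MV by (auto simp: poly_ring_def monomial_def)
    have IM: "genideal (poly_ring V) (monomial ` M) = I" "genideal (poly_ring V) (monomial ` N) = I"
      using M N by (simp_all add: minimal_monomial_generating_set_def)
    have "\<exists>n\<in>N. n \<subseteq># m"
    proof (rule monomial_in_genideal_imp)
      show "\<forall>u\<in>N. set_mset u \<subseteq> V" by (rule MV)
      show "(monomial m :: ('v, 'k) polynomial) \<in> genideal (poly_ring V) (monomial ` N)"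
        using R.genideal_self[OF car(1)] m unfolding IM by blast
    qed
    then obtain n where n: "n \<in> N" "n \<subseteq># m" by blast
    have "\<exists>m'\<in>M. m' \<subseteq># n"
    proof (rule monomial_in_genideal_imp)
      show "\<forall>u\<in>M. set_mset u \<subseteq> V" by (rule MV)
      show "(monomial n :: ('v, 'k) polynomial) \<in> genideal (poly_ring V) (monomial ` M)"
        using R.genideal_self[OF car(2)] n unfolding IM by blast
    qed
    then obtain m' where m': "m' \<in> M" "m' \<subseteq># n" by blast
    have "m' = m"
    proof (rule ccontr)
      assume ne: "m' \<noteq> m"
      let ?J = "genideal (poly_ring V) (monomial ` (M - {m})) :: ('v, 'k) polynomial set"
      have carJ: "monomial ` (M - {m}) \<subseteq> carrier (poly_ring V :: ('v, 'k) polynomial ring)"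
        using car by auto
      have J: "ideal ?J (poly_ring V)" by (rule R.genideal_ideal[OF carJ])
      have "m' \<subseteq># m" using m' n by (meson subset_mset.order_trans)
      then have "monomial m = (monomial (m - m') * monomial m' :: ('v, 'k) polynomial)"
        by (simp add: monomial_def mult_single)
      moreover have "monomial m' \<in> ?J" using R.genideal_self[OF carJ] m' ne by auto
      moreover have "monomial (m - m') \<in> carrier (poly_ring V :: ('v, 'k) polynomial ring)"
        using m MV(1) by (auto simp: poly_ring_def monomial_def dest!: in_diffD)
      ultimately have "(monomial m :: ('v, 'k) polynomial) \<in> ?J"
        using ideal.I_l_closed[OF J, of "monomial m'" "monomial (m - m')"]
        by (simp add: poly_ring_def)
      then have "monomial ` M \<subseteq> ?J" using R.genideal_self[OF carJ] by auto
      then have "I \<subseteq> ?J" using R.genideal_minimal[OF J] IM by auto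
      moreover have "?J \<subseteq> I"
        using R.subset_Idl_subset[OF car(1), of "monomial ` (M - {m})"] IM by auto
      ultimately have "?J = I" by blast
      moreover have "M - {m} \<subset> M" using m by blast
      ultimately show False using M unfolding minimal_monomial_generating_set_def by blast
    qed
    then have "n = m" using m' n by auto
    then show "m \<in> N" using n by simp
  qed
  show ?thesis
    by (intro subset_antisym sub[OF assms] sub[OF assms(2,1)])
qed

end

theory Submission
  imports Defs
begin

text \<open>
  A monomial lies in the \<open>n\<close>-th symbolic power iff its degree on every minimal vertex cover is at
  least \<open>n\<close>.  The minimal vertex covers of \<open>H\<close> are exactly the minimal members among the traces on
  \<open>H\<close> of minimal vertex covers of \<open>G\<close>, so for monomials supported on \<open>H\<close> the two conditions agree;
  a minimal generator has no exponent above \<open>n\<close>, hence divides \<open>m\<^sup>n\<close>.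

  For the Scarf property, restricting to the generators that divide a monomial \<open>u\<close> keeps exactly the
  faces whose label divides \<open>u\<close>.  In each multidegree \<open>v\<close> the restricted complex is therefore the full
  Scarf complex in multidegree \<open>gcd(v, u)\<close>, and exactness is inherited degree by degree.
\<close>


section \<open>Monomial ideals\<close>

lemma poly_ring_simps [simp]:
  "mult (poly_ring V) = (*)" "one (poly_ring V) = 1" "zero (poly_ring V) = 0" "add (poly_ring V) = (+)"
  by (simp_all add: poly_ring_def)

lemma carrier_poly_ring: "carrier (poly_ring V) = {p. \<forall>u\<in>Poly_Mapping.keys p. set_mset u \<subseteq> V}"
  by (simp add: poly_ring_def)

lemma a_inv_poly_ring:
  assumes "p \<in> carrier (poly_ring V :: ('v, 'k::field) polynomial ring)"
  shows "\<ominus>\<^bsub>poly_ring V\<^esub> p = - p"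
proof -
  interpret R: cring "poly_ring V :: ('v, 'k) polynomial ring" by (rule cring_poly_ring)
  show ?thesis
    by (rule sym, rule R.sum_zero_eq_neg) (use assms in \<open>auto simp: carrier_poly_ring keys_uminus_poly\<close>)
qed

lemma poly_eq_sum_single: "p = (\<Sum>w\<in>Poly_Mapping.keys p. Poly_Mapping.single w (Poly_Mapping.lookup p w))"
  by (intro poly_mapping_eqI) (simp add: lookup_sum lookup_single when_def in_keys_iff)

section \<open>Ideals described by their sets of monomials\<close>

definition upward_closed :: "'v multiset set \<Rightarrow> bool" where
  "upward_closed W \<longleftrightarrow> (\<forall>w\<in>W. \<forall>w'. w \<subseteq># w' \<longrightarrow> w' \<in> W)"

text \<open>Monomial ideals are handled through their monomials alone. \<open>W\<close> may contain
  monomials in variables outside \<open>V\<close>; the carrier condition discards them, so one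
  \<open>W\<close> serves every ambient ring.\<close>

definition monomial_span :: "'v set \<Rightarrow> 'v multiset set \<Rightarrow> ('v, 'k::field) polynomial set" where
  "monomial_span V W = {p \<in> carrier (poly_ring V). Poly_Mapping.keys p \<subseteq> W}"

lemma monomial_in_monomial_span [simp]:
  "(monomial w :: ('v, 'k::field) polynomial) \<in> monomial_span V W \<longleftrightarrow> set_mset w \<subseteq> V \<and> w \<in> W"
  by (simp add: monomial_span_def monomial_def carrier_poly_ring)

text \<open>Sums create no new monomials, and each monomial of \<open>x * a\<close> is a multiple of
  a monomial of \<open>a\<close>.\<close>

lemma ideal_monomial_span:
  assumes "upward_closed W"
  shows "ideal (monomial_span V W :: ('v, 'k::field) polynomial set) (poly_ring V)"
proof (rule idealI)
  interpret R: cring "poly_ring V :: ('v, 'k) polynomial ring" by (rule cring_poly_ring)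
  have mult: "x * a \<in> monomial_span V W"
    if "a \<in> monomial_span V W" "x \<in> carrier (poly_ring V)" for a x :: "('v, 'k) polynomial"
  proof -
    have "x * a \<in> carrier (poly_ring V)"
      using R.m_closed[of x a] that by (auto simp: monomial_span_def)
    moreover have "w \<in> W" if w: "w \<in> Poly_Mapping.keys (x * a)" for w
    proof -
      obtain s t where "w = s + t" "t \<in> Poly_Mapping.keys a"
        using w keys_mult[of x a] by blast
      then show ?thesis using \<open>a \<in> monomial_span V W\<close> assms
        by (metis (mono_tags, lifting) upward_closed_def mem_Collect_eq monomial_span_def
            mset_subset_eq_add_right subset_iff)
    qed
    ultimately show ?thesis by (auto simp: monomial_span_def)
  qed
  show "ring (poly_ring V :: ('v, 'k) polynomial ring)" by (rule R.ring_axioms)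
  show "subgroup (monomial_span V W :: ('v, 'k) polynomial set) (add_monoid (poly_ring V))"
  proof (rule group.subgroupI)
    show "group (add_monoid (poly_ring V :: ('v, 'k) polynomial ring))" by (rule R.a_group)
    have "0 \<in> (monomial_span V W :: ('v, 'k) polynomial set)"
      by (simp add: monomial_span_def carrier_poly_ring)
    then show "(monomial_span V W :: ('v, 'k) polynomial set) \<noteq> {}" by blast
    show "inv\<^bsub>add_monoid (poly_ring V)\<^esub> a \<in> monomial_span V W"
      if "a \<in> monomial_span V W" for a :: "('v, 'k) polynomial"
      using a_inv_poly_ring[of a V] that unfolding a_inv_def
      by (auto simp: monomial_span_def carrier_poly_ring keys_uminus_poly)
    show "a \<otimes>\<^bsub>add_monoid (poly_ring V)\<^esub> b \<in> monomial_span V W"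
      if "a \<in> monomial_span V W" "b \<in> monomial_span V W" for a b :: "('v, 'k) polynomial"
    proof -
      have "a + b \<in> monomial_span V W"
        using that Poly_Mapping.keys_add[of a b] unfolding monomial_span_def carrier_poly_ring by blast
      then show ?thesis by simp
    qed
  qed (auto simp: monomial_span_def)
  fix a x :: "('v, 'k) polynomial"
  assume "a \<in> monomial_span V W" "x \<in> carrier (poly_ring V)"
  then show "x \<otimes>\<^bsub>poly_ring V\<^esub> a \<in> monomial_span V W" "a \<otimes>\<^bsub>poly_ring V\<^esub> x \<in> monomial_span V W"
    using mult[of a x] by (auto simp: mult.commute)
qed

text \<open>A polynomial is the sum of its terms, so an inclusion of a span in an ideal need only be
  checked on monomials.\<close>

lemma monomial_span_subset:
  assumes I: "ideal I (poly_ring V :: ('v, 'k::field) polynomial ring)"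
    and W: "\<And>w. w \<in> W \<Longrightarrow> set_mset w \<subseteq> V \<Longrightarrow> monomial w \<in> I"
  shows "monomial_span V W \<subseteq> I"
proof
  fix p :: "('v, 'k) polynomial" assume p: "p \<in> monomial_span V W"
  interpret I: ideal I "poly_ring V :: ('v, 'k) polynomial ring" by (rule I)
  have "(\<Sum>w\<in>A. Poly_Mapping.single w (Poly_Mapping.lookup p w)) \<in> I"
    if "finite A" "A \<subseteq> Poly_Mapping.keys p" for A
    using that
  proof (induction A rule: finite_induct)
    case empty
    show ?case using additive_subgroup.zero_closed[OF ideal.axioms(1)[OF I]] by simp
  next
    case (insert w A)
    have w: "w \<in> W" "set_mset w \<subseteq> V"
      using insert.prems p by (auto simp: monomial_span_def carrier_poly_ring)
    \<comment> \<open>The coefficient enters as a constant polynomial, so absorption by the ideal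
      covers scalar multiples.\<close>
    have "Poly_Mapping.single {#} (Poly_Mapping.lookup p w) * monomial w \<in> I"
      using I.I_l_closed[OF W[OF w], of "Poly_Mapping.single {#} (Poly_Mapping.lookup p w)"]
      by (simp add: carrier_poly_ring)
    then show ?case
      using insert additive_subgroup.a_closed[OF ideal.axioms(1)[OF I]] by (simp add: monomial_def mult_single)
  qed
  from this[of "Poly_Mapping.keys p"] show "p \<in> I"
    by (simp flip: poly_eq_sum_single)
qed

lemma upward_closed_multiples: "upward_closed {w. \<exists>u\<in>M. u \<subseteq># w}"
  unfolding upward_closed_def using subset_mset.order_trans by fastforce

text \<open>The span of the multiples is an ideal containing the generators; conversely, a multiple
  \<open>w\<close> of \<open>u\<close> is the product of the quotient \<open>w - u\<close> and
  \<open>u\<close>. Generated ideals are computed through this formula from here on.\<close>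

lemma genideal_monomials:
  assumes "\<forall>u\<in>M. set_mset u \<subseteq> V"
  shows "genideal (poly_ring V) (monomial ` M)
       = (monomial_span V {w. \<exists>u\<in>M. u \<subseteq># w} :: ('v, 'k::field) polynomial set)"
proof
  interpret R: cring "poly_ring V :: ('v, 'k) polynomial ring" by (rule cring_poly_ring)
  have M: "monomial ` M \<subseteq> carrier (poly_ring V :: ('v, 'k) polynomial ring)"
    using assms by (auto simp: carrier_poly_ring monomial_def)
  show "genideal (poly_ring V) (monomial ` M)
      \<subseteq> (monomial_span V {w. \<exists>u\<in>M. u \<subseteq># w} :: ('v, 'k) polynomial set)"
    by (rule R.genideal_minimal[OF ideal_monomial_span[OF upward_closed_multiples]])
      (use assms in auto)
  show "monomial_span V {w. \<exists>u\<in>M. u \<subseteq># w}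
      \<subseteq> (genideal (poly_ring V) (monomial ` M) :: ('v, 'k) polynomial set)"
  proof (rule monomial_span_subset[OF R.genideal_ideal[OF M]])
    fix w assume "w \<in> {w. \<exists>u\<in>M. u \<subseteq># w}" and w: "set_mset w \<subseteq> V"
    then obtain u where u: "u \<in> M" "u \<subseteq># w" by blast
    have "(monomial u :: ('v, 'k) polynomial) \<in> genideal (poly_ring V) (monomial ` M)"
      using R.genideal_self[OF M] u by blast
    moreover have "(monomial (w - u) :: ('v, 'k) polynomial) \<in> carrier (poly_ring V)"
      using w by (auto simp: carrier_poly_ring monomial_def dest: in_diffD)
    ultimately have "(monomial (w - u) * monomial u :: ('v, 'k) polynomial)
        \<in> genideal (poly_ring V) (monomial ` M)"
      using ideal.I_l_closed[OF R.genideal_ideal[OF M]] by fastforce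
    then show "(monomial w :: ('v, 'k) polynomial) \<in> genideal (poly_ring V) (monomial ` M)"
      using u by (simp add: monomial_def mult_single)
  qed
qed

section \<open>Minimal generators as minimal elements under divisibility\<close>

definition minimal_elements :: "'v multiset set \<Rightarrow> 'v multiset set" where
  "minimal_elements W = {w \<in> W. \<forall>u\<in>W. u \<subseteq># w \<longrightarrow> u = w}"

text \<open>Proper divisors have smaller degree, so descent by \<open>size\<close>
  terminates.\<close>

lemma minimal_element_below:
  assumes "w \<in> W"
  shows "\<exists>m\<in>minimal_elements W. m \<subseteq># w"
  using assms
proof (induction w rule: measure_induct_rule[of size])
  case (less w)
  show ?case
  proof (cases "w \<in> minimal_elements W")
    case False
    then obtain u where u: "u \<in> W" "u \<subset># w"
      using less.prems by (auto simp: minimal_elements_def subset_mset.less_le)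
    then show ?thesis
      using less.IH[of u] by (meson mset_subset_size subset_mset.less_imp_le subset_mset.order_trans)
  qed auto
qed

text \<open>A dropped generator \<open>m\<close> would have to be a multiple of a remaining one,
  which in an antichain must be \<open>m\<close> itself.\<close>

lemma minimal_monomial_generating_set_antichain:
  assumes V: "\<forall>u\<in>M. set_mset u \<subseteq> V"
    and anti: "\<And>u w. u \<in> M \<Longrightarrow> w \<in> M \<Longrightarrow> u \<subseteq># w \<Longrightarrow> u = w"
  shows "minimal_monomial_generating_set V
           (genideal (poly_ring V) (monomial ` M) :: ('v, 'k::field) polynomial set) M"
  unfolding minimal_monomial_generating_set_def
proof (intro conjI allI impI V refl notI)
  fix N assume N: "N \<subset> M"
    and eq: "genideal (poly_ring V) (monomial ` N)
           = (genideal (poly_ring V) (monomial ` M) :: ('v, 'k) polynomial set)"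
  obtain m where m: "m \<in> M" "m \<notin> N" using N by blast
  have NV: "\<forall>u\<in>N. set_mset u \<subseteq> V" using V N by blast
  have "(monomial m :: ('v, 'k) polynomial) \<in> genideal (poly_ring V) (monomial ` N)"
    unfolding eq genideal_monomials[OF V] using V m by auto
  then obtain u where "u \<in> N" "u \<subseteq># m"
    unfolding genideal_monomials[OF NV] by auto
  then show False using anti[of u m] N m by auto
qed

lemma mingens_eq:
  "minimal_monomial_generating_set V I M \<Longrightarrow> mingens V I = M"
  unfolding mingens_def
  by (rule the_equality) (assumption, rule minimal_monomial_generating_set_unique)

lemma minimal_monomial_generating_set_minimal_elements:
  assumes W: "upward_closed W"
  shows "minimal_monomial_generating_set V (monomial_span V W :: ('v, 'k::field) polynomial set)
           (minimal_elements {w \<in> W. set_mset w \<subseteq> V})"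
proof -
  let ?M = "minimal_elements {w \<in> W. set_mset w \<subseteq> V}"
  have V: "\<forall>u\<in>?M. set_mset u \<subseteq> V"
    by (simp add: minimal_elements_def)
  have "(\<exists>u\<in>?M. u \<subseteq># w) \<longleftrightarrow> w \<in> W" if "set_mset w \<subseteq> V" for w
  proof
    assume "\<exists>u\<in>?M. u \<subseteq># w"
    then show "w \<in> W" using W unfolding minimal_elements_def upward_closed_def by blast
  next
    assume "w \<in> W"
    then show "\<exists>u\<in>?M. u \<subseteq># w" using that by (intro minimal_element_below) simp
  qed
  then have "(monomial_span V {w. \<exists>u\<in>?M. u \<subseteq># w} :: ('v, 'k) polynomial set) = monomial_span V W"
    unfolding monomial_span_def carrier_poly_ring by blast
  then show ?thesis
    using minimal_monomial_generating_set_antichain[OF V, where 'k = 'k]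
    unfolding genideal_monomials[OF V] by (simp add: minimal_elements_def)
qed

section \<open>Powers of ideals generated by variables\<close>

lemma var_ideal_eq:
  assumes "A \<subseteq> V"
  shows "(var_ideal V A :: ('v, 'k::field) polynomial set)
       = monomial_span V {w. 1 \<le> size (filter_mset (\<lambda>x. x \<in> A) w)}"
proof -
  have "{w. \<exists>u\<in>(\<lambda>x. {#x#}) ` A. u \<subseteq># w} = {w. 1 \<le> size (filter_mset (\<lambda>x. x \<in> A) w)}"
    by (auto simp: Suc_le_eq nonempty_has_size[symmetric] filter_mset_eq_conv)
  moreover have "(var :: 'v \<Rightarrow> ('v, 'k) polynomial) ` A = monomial ` (\<lambda>x. {#x#}) ` A"
    by (simp add: image_image var_def)
  moreover have "\<forall>u\<in>(\<lambda>x. {#x#}) ` A. set_mset u \<subseteq> V"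
    using assms by auto
  ultimately show ?thesis
    using genideal_monomials[of "(\<lambda>x. {#x#}) ` A" V, where 'k = 'k]
    by (simp only: var_ideal_def)
qed

lemma upward_closed_degree: "upward_closed {w. n \<le> size (filter_mset P w)}"
  unfolding upward_closed_def
proof safe
  fix w w' :: "'a multiset"
  assume "n \<le> size (filter_mset P w)" "w \<subseteq># w'"
  then show "n \<le> size (filter_mset P w')"
    using size_mset_mono[OF multiset_filter_mono] order_trans by blast
qed

text \<open>The degree in the variables of \<open>A\<close> is additive, so products have degree at
  least \<open>n + 1\<close>. Conversely, a monomial of that degree is a variable from
  \<open>A\<close> times a monomial of degree at least \<open>n\<close>.\<close>

lemma ideal_power_var_ideal:
  assumes A: "A \<subseteq> V"
  shows "(ideal_power V (var_ideal V A) n :: ('v, 'k::field) polynomial set)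
       = monomial_span V {w. n \<le> size (filter_mset (\<lambda>x. x \<in> A) w)}"
proof (induction n)
  case 0
  show ?case by (simp add: ideal_power_def monomial_span_def)
next
  case (Suc n)
  let ?S = "\<lambda>n. monomial_span V {w. n \<le> size (filter_mset (\<lambda>x. x \<in> A) w)} :: ('v, 'k) polynomial set"
  interpret R: cring "poly_ring V :: ('v, 'k) polynomial ring" by (rule cring_poly_ring)
  have id: "ideal (?S k) (poly_ring V)" for k
    by (rule ideal_monomial_span[OF upward_closed_degree])
  have "ideal_power V (var_ideal V A) (Suc n)
      = ideal_prod (poly_ring V) (var_ideal V A) (ideal_power V (var_ideal V A) n :: ('v, 'k) polynomial set)"
    by (simp add: ideal_power_def)
  also have "\<dots> = ideal_prod (poly_ring V) (?S 1) (?S n)"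
    by (subst Suc.IH, subst var_ideal_eq[OF A]) (rule refl)
  also have "\<dots> = ?S (Suc n)"
  proof
    show "ideal_prod (poly_ring V) (?S 1) (?S n) \<subseteq> ?S (Suc n)"
    proof
      fix p assume "p \<in> ideal_prod (poly_ring V) (?S 1) (?S n)"
      then show "p \<in> ?S (Suc n)"
      proof (induction rule: ideal_prod.induct)
        case (prod i j)
        have "i * j \<in> carrier (poly_ring V)"
          using R.m_closed[of i j] prod by (simp add: monomial_span_def)
        moreover have "Suc n \<le> size (filter_mset (\<lambda>x. x \<in> A) w)"
          if w: "w \<in> Poly_Mapping.keys (i * j)" for w
        proof -
          obtain s t where st: "w = s + t" "s \<in> Poly_Mapping.keys i" "t \<in> Poly_Mapping.keys j"
            using w keys_mult[of i j] by blast
          have "1 \<le> size (filter_mset (\<lambda>x. x \<in> A) s)" "n \<le> size (filter_mset (\<lambda>x. x \<in> A) t)"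
            using st prod unfolding monomial_span_def by blast+
          then show ?thesis using st by simp
        qed
        ultimately show ?case unfolding monomial_span_def by auto
      next
        case (sum s1 s2)
        then show ?case
          using additive_subgroup.a_closed[OF ideal.axioms(1)[OF id]] by fastforce
      qed
    qed
    show "?S (Suc n) \<subseteq> ideal_prod (poly_ring V) (?S 1) (?S n)"
    proof (rule monomial_span_subset[OF R.ideal_prod_is_ideal[OF id id]])
      fix w assume "w \<in> {w. Suc n \<le> size (filter_mset (\<lambda>x. x \<in> A) w)}" and wV: "set_mset w \<subseteq> V"
      then have w: "Suc n \<le> size (filter_mset (\<lambda>x. x \<in> A) w)" by blast
      then have "filter_mset (\<lambda>x. x \<in> A) w \<noteq> {#}" by fastforce
      then obtain x where x: "x \<in># w" "x \<in> A" unfolding filter_mset_eq_mempty_iff by blast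
      then obtain w' where w': "w = add_mset x w'" by (meson mset_add)
      \<comment> \<open>Removing a single \<open>x\<close> from \<open>A\<close> lowers the degree
        in \<open>A\<close> by exactly one.\<close>
      have "monomial {#x#} \<in> ?S 1" "monomial w' \<in> ?S n"
        using x w wV w' by auto
      then have "monomial {#x#} \<otimes>\<^bsub>poly_ring V\<^esub> monomial w' \<in> ideal_prod (poly_ring V) (?S 1) (?S n)"
        by (rule ideal_prod.prod)
      then show "monomial w \<in> ideal_prod (poly_ring V) (?S 1) (?S n)"
        by (simp add: w' monomial_def mult_single)
    qed
  qed
  finally show ?case .
qed


section \<open>Symbolic powers and induced subgraphs\<close>

text \<open>No ambient variable set occurs here, so the monomial conditions of \<open>G\<close> and
  of \<open>H\<close> can be compared directly.\<close>

definition symbolic_power_monomials :: "'v graph \<Rightarrow> nat \<Rightarrow> 'v multiset set" where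
  "symbolic_power_monomials K n =
     {w. \<forall>A\<in>minimal_vertex_covers K. n \<le> size (filter_mset (\<lambda>x. x \<in> A) w)}"

lemma upward_closed_INT:
  "(\<And>i. i \<in> I \<Longrightarrow> upward_closed (W i)) \<Longrightarrow> upward_closed (\<Inter>i\<in>I. W i)"
  by (auto simp: upward_closed_def)

lemma upward_closed_symbolic_power_monomials: "upward_closed (symbolic_power_monomials K n)"
proof -
  have "symbolic_power_monomials K n
      = (\<Inter>A\<in>minimal_vertex_covers K. {w. n \<le> size (filter_mset (\<lambda>x. x \<in> A) w)})"
    by (auto simp: symbolic_power_monomials_def)
  then show ?thesis
    by (simp only:) (intro upward_closed_INT upward_closed_degree)
qed

section \<open>Vertex covers of a graph and of its induced subgraphs\<close>

lemma vertex_cover_contains_minimal: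
  assumes "finite A" "vertex_cover K A"
  shows "\<exists>B\<in>minimal_vertex_covers K. B \<subseteq> A"
  using assms
proof (induction A rule: finite_psubset_induct)
  case (psubset A)
  show ?case
  proof (cases "\<exists>B. B \<subset> A \<and> vertex_cover K B")
    case True
    then obtain B where B: "B \<subset> A" "vertex_cover K B" by blast
    then obtain C where "C \<in> minimal_vertex_covers K" "C \<subseteq> B" using psubset.IH by meson
    then show ?thesis using B by blast
  next
    case False
    then have "A \<in> minimal_vertex_covers K"
      using psubset.prems unfolding minimal_vertex_covers_def by blast
    then show ?thesis by blast
  qed
qed

lemma vertex_cover_verts: "finite_simple_graph K \<Longrightarrow> vertex_cover K (verts K)"
  unfolding vertex_cover_def
proof (intro conjI ballI subset_refl)
  fix e assume "finite_simple_graph K" "e \<in> edges K"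
  then have "e \<subseteq> verts K" "card e = 2" by (simp_all add: finite_simple_graph_def)
  then show "e \<inter> verts K \<noteq> {}" by (auto simp: Int_absorb2)
qed

lemma finite_simple_graph_induced:
  "finite_simple_graph G \<Longrightarrow> induced_subgraph_of H G \<Longrightarrow> finite_simple_graph H"
  using finite_subset[of "verts H" "verts G"] by (simp add: finite_simple_graph_def induced_subgraph_of_def)

lemma edge_ideal_symbolic_power_eq:
  assumes "finite_simple_graph K" "verts K \<subseteq> V"
  shows "(edge_ideal_symbolic_power V K n :: ('v, 'k::field) polynomial set)
       = monomial_span V (symbolic_power_monomials K n)"
proof -
  \<comment> \<open>An intersection over no covers would be the whole type, including polynomials
    outside the ring.\<close>
  have "minimal_vertex_covers K \<noteq> {}"
    using vertex_cover_contains_minimal[OF _ vertex_cover_verts[OF assms(1)]] assms(1)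
    by (auto simp: finite_simple_graph_def)
  moreover have "A \<subseteq> V" if "A \<in> minimal_vertex_covers K" for A
    using that assms by (auto simp: minimal_vertex_covers_def vertex_cover_def)
  ultimately show ?thesis
    by (auto simp: edge_ideal_symbolic_power_def ideal_power_var_ideal monomial_span_def
        symbolic_power_monomials_def)
qed

text \<open>The trace on \<open>H\<close> of a cover of \<open>G\<close> covers \<open>H\<close>,
  since edges of \<open>H\<close> lie inside \<open>verts H\<close>. The second claim shrinks this
  trace to a minimal cover. The first enlarges \<open>B\<close> to a cover of \<open>G\<close>
  without adding vertices of \<open>H\<close> and then shrinks.\<close>

lemma minimal_vertex_covers_induced:
  assumes fin: "finite_simple_graph G" and H: "induced_subgraph_of H G"
  shows "B \<in> minimal_vertex_covers H \<Longrightarrow> \<exists>A\<in>minimal_vertex_covers G. A \<inter> verts H = B"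
    and "A \<in> minimal_vertex_covers G \<Longrightarrow> \<exists>B\<in>minimal_vertex_covers H. B \<subseteq> A"
proof -
  have trace: "vertex_cover H (A \<inter> verts H)" if "vertex_cover G A" for A
    unfolding vertex_cover_def
  proof (intro conjI ballI)
    fix e assume "e \<in> edges H"
    then have "e \<inter> A \<noteq> {}" "e \<subseteq> verts H"
      using that H by (simp_all add: vertex_cover_def induced_subgraph_of_def)
    then show "e \<inter> (A \<inter> verts H) \<noteq> {}" by blast
  qed simp
  have finG: "finite (verts G)" using fin by (simp add: finite_simple_graph_def)
  {
    assume B: "B \<in> minimal_vertex_covers H"
    then have BH: "B \<subseteq> verts H" "vertex_cover H B"
      by (auto simp: minimal_vertex_covers_def vertex_cover_def)
    \<comment> \<open>An edge of \<open>G\<close> either is an edge of \<open>H\<close>, met by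
      \<open>B\<close>, or has an endpoint outside \<open>H\<close>.\<close>
    let ?C = "B \<union> (verts G - verts H)"
    have C: "vertex_cover G ?C"
      unfolding vertex_cover_def
    proof (intro conjI ballI)
      show "?C \<subseteq> verts G" using BH H by (auto simp: induced_subgraph_of_def)
      fix e assume e: "e \<in> edges G"
      then have "e \<subseteq> verts G" using fin by (simp add: finite_simple_graph_def)
      then show "e \<inter> ?C \<noteq> {}"
        using BH H e by (cases "e \<subseteq> verts H") (auto simp: vertex_cover_def induced_subgraph_of_def)
    qed
    moreover have "finite ?C" using BH H finG
      by (auto simp: induced_subgraph_of_def intro: finite_subset)
    ultimately obtain A where A: "A \<in> minimal_vertex_covers G" "A \<subseteq> ?C"
      using vertex_cover_contains_minimal by blast
    then have "vertex_cover H (A \<inter> verts H)" "A \<inter> verts H \<subseteq> B"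
      using trace by (auto simp: minimal_vertex_covers_def)
    \<comment> \<open>The trace is a cover of \<open>H\<close> inside the minimal cover
      \<open>B\<close>.\<close>
    then have "A \<inter> verts H = B"
      using B by (auto simp: minimal_vertex_covers_def)
    then show "\<exists>A\<in>minimal_vertex_covers G. A \<inter> verts H = B" using A by blast
  }
  assume A: "A \<in> minimal_vertex_covers G"
  then have "vertex_cover H (A \<inter> verts H)"
    using trace by (simp add: minimal_vertex_covers_def)
  moreover have "finite (A \<inter> verts H)"
    using H finG by (auto simp: induced_subgraph_of_def intro: finite_subset)
  ultimately obtain B where "B \<in> minimal_vertex_covers H" "B \<subseteq> A \<inter> verts H"
    using vertex_cover_contains_minimal by meson
  then show "\<exists>B\<in>minimal_vertex_covers H. B \<subseteq> A" by blast
qed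

text \<open>Each minimal cover of \<open>G\<close> contains one of \<open>H\<close>, and the degree
  grows with the cover. Conversely, each minimal cover of \<open>H\<close> is a trace of one of
  \<open>G\<close>, and for a monomial supported on \<open>H\<close> passing to the trace leaves the
  degree unchanged.\<close>

lemma symbolic_power_monomials_induced:
  assumes fin: "finite_simple_graph G" and H: "induced_subgraph_of H G"
  shows "symbolic_power_monomials H n \<subseteq> symbolic_power_monomials G n"
    and "w \<in> symbolic_power_monomials G n \<Longrightarrow> set_mset w \<subseteq> verts H \<Longrightarrow> w \<in> symbolic_power_monomials H n"
proof -
  show "symbolic_power_monomials H n \<subseteq> symbolic_power_monomials G n"
  proof
    fix w assume w: "w \<in> symbolic_power_monomials H n"
    show "w \<in> symbolic_power_monomials G n"
      unfolding symbolic_power_monomials_def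
    proof safe
      fix A assume "A \<in> minimal_vertex_covers G"
      then obtain B where B: "B \<in> minimal_vertex_covers H" "B \<subseteq> A"
        using minimal_vertex_covers_induced(2)[OF assms] by blast
      have "filter_mset (\<lambda>x. x \<in> B) w \<subseteq># filter_mset (\<lambda>x. x \<in> A) w"
        using B by (auto simp: subseteq_mset_def)
      then show "n \<le> size (filter_mset (\<lambda>x. x \<in> A) w)"
        using w B size_mset_mono order_trans unfolding symbolic_power_monomials_def by blast
    qed
  qed
  assume w: "w \<in> symbolic_power_monomials G n" "set_mset w \<subseteq> verts H"
  show "w \<in> symbolic_power_monomials H n"
    unfolding symbolic_power_monomials_def
  proof safe
    fix B assume "B \<in> minimal_vertex_covers H"
    then obtain A where A: "A \<in> minimal_vertex_covers G" "A \<inter> verts H = B"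
      using minimal_vertex_covers_induced(1)[OF assms] by blast
    have "filter_mset (\<lambda>x. x \<in> B) w = filter_mset (\<lambda>x. x \<in> A) w"
      using A w by (intro filter_mset_cong) auto
    then show "n \<le> size (filter_mset (\<lambda>x. x \<in> B) w)"
      using w A by (auto simp: symbolic_power_monomials_def)
  qed
qed

text \<open>
  Either some exponent on the cover is truncated, and then it alone contributes degree \<open>n\<close>, or the
  degree on the cover does not change.
\<close>

lemma symbolic_power_monomials_truncate:
  assumes fin: "finite (verts K)" and w: "w \<in> symbolic_power_monomials K n"
  shows "w \<inter># repeat_mset n (mset_set (verts K)) \<in> symbolic_power_monomials K n"
  unfolding symbolic_power_monomials_def
proof safe
  fix A assume A: "A \<in> minimal_vertex_covers K"
  then have AV: "A \<subseteq> verts K" by (auto simp: minimal_vertex_covers_def vertex_cover_def)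
  let ?t = "w \<inter># repeat_mset n (mset_set (verts K))"
  show "n \<le> size (filter_mset (\<lambda>x. x \<in> A) ?t)"
  proof (cases "\<exists>x\<in>A. n \<le> count w x")
    case True
    then obtain x where x: "x \<in> A" "n \<le> count w x" by blast
    then have "n = count (filter_mset (\<lambda>x. x \<in> A) ?t) x"
      using AV fin by (auto simp: count_mset_set')
    also have "\<dots> \<le> size (filter_mset (\<lambda>x. x \<in> A) ?t)"
      by (rule count_le_size)
    finally show ?thesis .
  next
    case False
    then have "filter_mset (\<lambda>x. x \<in> A) ?t = filter_mset (\<lambda>x. x \<in> A) w"
      using AV fin by (intro multiset_eqI) (auto simp: count_mset_set')
    then show ?thesis using w A by (auto simp: symbolic_power_monomials_def)
  qed
qed

section \<open>Exponent bounds for minimal generators of symbolic powers\<close>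

lemma set_mset_below_repeat_mset:
  "finite A \<Longrightarrow> u \<subseteq># repeat_mset n (mset_set A) \<Longrightarrow> set_mset u \<subseteq> A"
  by (auto dest!: mset_subset_eqD simp: count_mset_set' split: if_splits simp flip: count_greater_zero_iff)

text \<open>Together with the exponent bound this makes the generating set finite. In the induction
  a divisor of \<open>add_mset x u\<close> either divides \<open>u\<close> or is \<open>x\<close>
  times a divisor of \<open>u\<close>.\<close>

lemma finite_multisets_below: "finite {w. w \<subseteq># (u :: 'v multiset)}"
proof (induction u)
  case (add x u)
  have "w \<in> {w. w \<subseteq># u} \<union> add_mset x ` {w. w \<subseteq># u}" if w: "w \<subseteq># add_mset x u" for w
  proof (cases "x \<in># w")
    case True
    then have "w = add_mset x (w - {#x#})" by simp
    moreover have "w - {#x#} \<subseteq># u" using w True by (simp add: subset_eq_diff_conv)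
    ultimately show ?thesis by blast
  next
    case False
    then have "w \<subseteq># u"
      using w by (metis add_mset_add_single diff_single_trivial subset_eq_diff_conv)
    then show ?thesis by blast
  qed
  then have "{w. w \<subseteq># add_mset x u} \<subseteq> {w. w \<subseteq># u} \<union> add_mset x ` {w. w \<subseteq># u}"
    by blast
  then show ?case using add.IH by (meson finite_UnI finite_imageI finite_subset)
qed simp

text \<open>Truncating the exponents of \<open>m\<close> at \<open>n\<close> gives a divisor of
  \<open>m\<close> satisfying the same degree conditions, so minimality forces it to be
  \<open>m\<close>.\<close>

lemma minimal_elements_symbolic_power_le:
  assumes K: "finite_simple_graph K" "verts K \<subseteq> V"
    and m: "m \<in> minimal_elements {w \<in> symbolic_power_monomials K n. set_mset w \<subseteq> V}"
  shows "m \<subseteq># repeat_mset n (mset_set (verts K))"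
proof -
  let ?t = "m \<inter># repeat_mset n (mset_set (verts K))"
  have "?t \<in> symbolic_power_monomials K n"
    using symbolic_power_monomials_truncate K m
    by (auto simp: finite_simple_graph_def minimal_elements_def)
  moreover have "set_mset ?t \<subseteq> V" using m by (auto simp: minimal_elements_def)
  ultimately have "?t = m" using m by (auto simp: minimal_elements_def)
  then show ?thesis by (metis subset_mset.inf_le2)
qed

text \<open>Divisors of \<open>repeat_mset n (mset_set (verts H))\<close> are supported on
  \<open>H\<close>, where the two sets of monomials agree. Their own divisors stay there too, so
  minimality means the same on both sides.\<close>

lemma minimal_elements_symbolic_power_induced:
  assumes fin: "finite_simple_graph G" and H: "induced_subgraph_of H G"
  shows "{w \<in> minimal_elements {w \<in> symbolic_power_monomials G n. set_mset w \<subseteq> verts G}.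
            w \<subseteq># repeat_mset n (mset_set (verts H))}
       = minimal_elements {w \<in> symbolic_power_monomials H n. set_mset w \<subseteq> verts G}"
    (is "?L = ?R")
proof
  have HG: "verts H \<subseteq> verts G" and finH: "finite (verts H)" and H': "finite_simple_graph H"
    using H fin finite_simple_graph_induced[OF fin H]
    by (auto simp: induced_subgraph_of_def finite_simple_graph_def)
  note le = set_mset_below_repeat_mset[OF finH]
  note sym = symbolic_power_monomials_induced[OF fin H]
  show "?L \<subseteq> ?R"
    using sym(1)[of n] sym(2)[of _ n] le[of _ n] unfolding minimal_elements_def by blast
  show "?R \<subseteq> ?L"
  proof
    fix m assume m: "m \<in> ?R"
    \<comment> \<open>The exponent bound for \<open>H\<close> holds although minimality is taken
      among monomials in all vertices of \<open>G\<close>.\<close>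
    have mn: "m \<subseteq># repeat_mset n (mset_set (verts H))"
      by (rule minimal_elements_symbolic_power_le[OF H' HG m])
    have "u = m" if "u \<in> symbolic_power_monomials G n" "set_mset u \<subseteq> verts G" "u \<subseteq># m" for u
    proof -
      have "u \<in> symbolic_power_monomials H n"
        using that mn by (intro sym(2) le) (auto intro: subset_mset.order_trans)
      then show ?thesis using that m by (auto simp: minimal_elements_def)
    qed
    then show "m \<in> ?L" using m mn sym(1)[of n] by (auto simp: minimal_elements_def)
  qed
qed


section \<open>Restriction of Scarf complexes\<close>

lemma Sup_multiset_le_iff:
  "finite \<sigma> \<Longrightarrow> Sup \<sigma> \<subseteq># v \<longleftrightarrow> (\<forall>m\<in>\<sigma>. m \<subseteq># (v :: 'v multiset))"
  by (cases "\<sigma> = {}") (auto simp: subset_mset.cSup_le_iff subset_mset.bdd_above_finite Sup_multiset_empty)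

lemma Sup_multiset_mono:
  "finite \<sigma> \<Longrightarrow> \<tau> \<subseteq> \<sigma> \<Longrightarrow> Sup \<tau> \<subseteq># Sup (\<sigma> :: 'v multiset set)"
  by (meson Sup_multiset_le_iff finite_subset subsetD subset_mset.order_refl)

lemma lookup_mult_monomial:
  fixes p :: "('v, 'k::field) polynomial"
  shows "Poly_Mapping.lookup (p * monomial \<delta>) w = (if \<delta> \<subseteq># w then Poly_Mapping.lookup p (w - \<delta>) else 0)"
proof -
  have "p * monomial \<delta>
      = (\<Sum>u\<in>Poly_Mapping.keys p. Poly_Mapping.single u (Poly_Mapping.lookup p u)) * monomial \<delta>"
    by (simp flip: poly_eq_sum_single)
  also have "\<dots> = (\<Sum>u\<in>Poly_Mapping.keys p. Poly_Mapping.single (u + \<delta>) (Poly_Mapping.lookup p u))"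
    by (simp add: sum_distrib_right monomial_def mult_single)
  finally have *: "Poly_Mapping.lookup (p * monomial \<delta>) w
      = (\<Sum>u\<in>Poly_Mapping.keys p. if u + \<delta> = w then Poly_Mapping.lookup p u else 0)"
    by (simp add: lookup_sum lookup_single when_def)
  show ?thesis
  proof (cases "\<delta> \<subseteq># w")
    case True
    then have "u + \<delta> = w \<longleftrightarrow> u = w - \<delta>" for u by auto
    then show ?thesis using True by (simp add: * in_keys_iff)
  next
    case False
    then have "u + \<delta> \<noteq> w" for u by auto
    then show ?thesis using False by (simp add: *)
  qed
qed

section \<open>The Taylor differential by multidegree\<close>

lemma lookup_mult_sign:
  fixes p :: "('v, 'k::field) polynomial"
  shows "Poly_Mapping.lookup (p * (- 1) ^ k) w = (- 1) ^ k * Poly_Mapping.lookup p w"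
  by (cases "even k") auto

text \<open>The double sum is reorganised by target: the faces with \<tau> as a facet are the sets
  \<open>insert m \<tau>\<close> with \<open>m\<close> outside \<tau>. Summing over the fixed set
  \<open>M\<close> makes the index set independent of \<open>c\<close>.\<close>

lemma lookup_taylor_differential:
  assumes M: "finite M" and c: "Poly_Mapping.keys c \<subseteq> Pow M"
  shows "Poly_Mapping.lookup (taylor_differential idx c) \<tau>
       = (\<Sum>m\<in>M - \<tau>. Poly_Mapping.lookup c (insert m \<tau>)
            * (- 1) ^ card {m' \<in> insert m \<tau>. idx m' < idx m}
            * monomial (Sup (insert m \<tau>) - Sup \<tau>))"
proof -
  define X where "X \<sigma> m = Poly_Mapping.lookup c \<sigma> * (- 1) ^ card {m' \<in> \<sigma>. idx m' < idx m} *
             monomial (Sup \<sigma> - Sup (\<sigma> - {m}))" for \<sigma> m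
  have X0: "X \<sigma> m = 0" if "\<sigma> \<notin> Poly_Mapping.keys c" for \<sigma> m
    using that by (simp add: X_def in_keys_iff)
  have "Poly_Mapping.lookup (taylor_differential idx c) \<tau>
      = (\<Sum>\<sigma>\<in>Poly_Mapping.keys c. \<Sum>m\<in>\<sigma>. if \<sigma> - {m} = \<tau> then X \<sigma> m else 0)"
    by (simp add: taylor_differential_def lookup_sum lookup_single when_def X_def cong: if_cong)
  also have "\<dots> = (\<Sum>\<sigma>\<in>Poly_Mapping.keys c. \<Sum>m\<in>M. if m \<in> \<sigma> \<and> \<sigma> - {m} = \<tau> then X \<sigma> m else 0)"
  proof (rule sum.cong[OF refl])
    fix \<sigma> assume "\<sigma> \<in> Poly_Mapping.keys c"
    then have "\<sigma> \<subseteq> M" using c by blast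
    then show "(\<Sum>m\<in>\<sigma>. if \<sigma> - {m} = \<tau> then X \<sigma> m else 0)
        = (\<Sum>m\<in>M. if m \<in> \<sigma> \<and> \<sigma> - {m} = \<tau> then X \<sigma> m else 0)"
      using M by (intro sum.mono_neutral_cong_left) auto
  qed
  also have "\<dots> = (\<Sum>\<sigma>\<in>Pow M. \<Sum>m\<in>M. if m \<in> \<sigma> \<and> \<sigma> - {m} = \<tau> then X \<sigma> m else 0)"
    using M c by (intro sum.mono_neutral_left) (auto simp: X0 cong: if_cong)
  also have "\<dots> = (\<Sum>m\<in>M. \<Sum>\<sigma>\<in>Pow M. if m \<in> \<sigma> \<and> \<sigma> - {m} = \<tau> then X \<sigma> m else 0)"
    by (rule sum.swap)
  also have "\<dots> = (\<Sum>m\<in>M. if m \<notin> \<tau> then X (insert m \<tau>) m else 0)"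
  proof (rule sum.cong[OF refl])
    fix m assume m: "m \<in> M"
    have "(\<Sum>\<sigma>\<in>Pow M. if m \<in> \<sigma> \<and> \<sigma> - {m} = \<tau> then X \<sigma> m else 0)
        = (\<Sum>\<sigma>\<in>Pow M. if \<sigma> = insert m \<tau> then (if m \<notin> \<tau> then X (insert m \<tau>) m else 0) else 0)"
      by (rule sum.cong[OF refl]) auto
    also have "\<dots> = (if insert m \<tau> \<in> Pow M then (if m \<notin> \<tau> then X (insert m \<tau>) m else 0) else 0)"
      using M by (intro sum.delta) simp
    also have "\<dots> = (if m \<notin> \<tau> then X (insert m \<tau>) m else 0)"
      using X0[of "insert m \<tau>" m] c by auto
    finally show "(\<Sum>\<sigma>\<in>Pow M. if m \<in> \<sigma> \<and> \<sigma> - {m} = \<tau> then X \<sigma> m else 0)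
        = (if m \<notin> \<tau> then X (insert m \<tau>) m else 0)" .
  qed
  also have "\<dots> = (\<Sum>m\<in>M - \<tau>. X (insert m \<tau>) m)"
    using M by (intro sum.mono_neutral_cong_right) auto
  also have "\<dots> = (\<Sum>m\<in>M - \<tau>. Poly_Mapping.lookup c (insert m \<tau>)
            * (- 1) ^ card {m' \<in> insert m \<tau>. idx m' < idx m}
            * monomial (Sup (insert m \<tau>) - Sup \<tau>))"
    by (intro sum.cong refl) (simp add: X_def)
  finally show ?thesis .
qed

text \<open>The basis element of \<open>\<sigma>\<close> has multidegree \<open>Sup \<sigma>\<close>.\<close>

definition graded_coeff :: "('v, 'k::field) chain \<Rightarrow> 'v multiset \<Rightarrow> 'v multiset set \<Rightarrow> 'k" where
  "graded_coeff c v \<sigma> =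
     (if Sup \<sigma> \<subseteq># v then Poly_Mapping.lookup (Poly_Mapping.lookup c \<sigma>) (v - Sup \<sigma>) else 0)"

text \<open>This is the signed simplicial boundary over the field: within one multidegree the lcm
  quotients of the Taylor differential disappear.\<close>

definition boundary ::
    "('v multiset \<Rightarrow> nat) \<Rightarrow> 'v multiset set \<Rightarrow> ('v multiset set \<Rightarrow> 'k::field) \<Rightarrow> 'v multiset set \<Rightarrow> 'k" where
  "boundary idx M a \<tau> =
     (\<Sum>m\<in>M - \<tau>. (- 1) ^ card {m' \<in> insert m \<tau>. idx m' < idx m} * a (insert m \<tau>))"

lemma graded_coeff_add_Sup [simp]:
  "graded_coeff c (w + Sup \<sigma>) \<sigma> = Poly_Mapping.lookup (Poly_Mapping.lookup c \<sigma>) w"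
  by (simp add: graded_coeff_def)

text \<open>The coefficient of the monomial \<open>w\<close> at \<sigma> is recovered in multidegree
  \<open>w + Sup \<sigma>\<close>.\<close>

lemma chain_eqI:
  assumes "\<And>v \<sigma>. graded_coeff c v \<sigma> = graded_coeff c' v \<sigma>"
  shows "c = c'"
  by (intro poly_mapping_eqI) (metis assms graded_coeff_add_Sup)

lemma graded_coeff_0 [simp]: "graded_coeff 0 v \<sigma> = 0"
  by (simp add: graded_coeff_def)

lemma graded_coeff_nonzeroD:
  assumes "graded_coeff c v \<sigma> \<noteq> 0"
  shows "Sup \<sigma> \<subseteq># v" "v - Sup \<sigma> \<in> Poly_Mapping.keys (Poly_Mapping.lookup c \<sigma>)"
    "\<sigma> \<in> Poly_Mapping.keys c"
proof -
  show *: "Sup \<sigma> \<subseteq># v" "v - Sup \<sigma> \<in> Poly_Mapping.keys (Poly_Mapping.lookup c \<sigma>)"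
    using assms by (auto simp: graded_coeff_def in_keys_iff split: if_splits)
  show "\<sigma> \<in> Poly_Mapping.keys c" using *(2) by (auto simp: in_keys_iff)
qed

text \<open>The differential is homogeneous: the quotient of labels turns the exponent
  \<open>v - Sup (insert m \<tau>)\<close> into \<open>v - Sup \<tau>\<close>. On the right
  \<open>v\<close> enters only through the coefficients, which allows components to be moved between
  multidegrees.\<close>

lemma graded_coeff_taylor_differential:
  assumes M: "finite M" and c: "Poly_Mapping.keys c \<subseteq> Pow M"
  shows "graded_coeff (taylor_differential idx c) v \<tau> = boundary idx M (graded_coeff c v) \<tau>"
proof -
  have "graded_coeff (taylor_differential idx c) v \<tau>
      = (\<Sum>m\<in>M - \<tau>. if Sup \<tau> \<subseteq># v then
          (- 1) ^ card {m' \<in> insert m \<tau>. idx m' < idx m} *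
          (if Sup (insert m \<tau>) - Sup \<tau> \<subseteq># v - Sup \<tau>
           then Poly_Mapping.lookup (Poly_Mapping.lookup c (insert m \<tau>))
                  (v - Sup \<tau> - (Sup (insert m \<tau>) - Sup \<tau>)) else 0) else 0)"
    by (auto simp: graded_coeff_def lookup_taylor_differential[OF M c] lookup_sum lookup_mult_sign
        lookup_mult_monomial intro!: sum.cong)
  also have "\<dots> = boundary idx M (graded_coeff c v) \<tau>"
    unfolding boundary_def
  proof (rule sum.cong[OF refl])
    fix m assume "m \<in> M - \<tau>"
    let ?s = "(- 1) ^ card {m' \<in> insert m \<tau>. idx m' < idx m} :: 'b"
    show "(if Sup \<tau> \<subseteq># v then ?s *
          (if Sup (insert m \<tau>) - Sup \<tau> \<subseteq># v - Sup \<tau>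
           then Poly_Mapping.lookup (Poly_Mapping.lookup c (insert m \<tau>))
                  (v - Sup \<tau> - (Sup (insert m \<tau>) - Sup \<tau>)) else 0) else 0)
        = ?s * graded_coeff c v (insert m \<tau>)"
    \<comment> \<open>Faces in the support of \<open>c\<close> are finite, which makes
      \<open>Sup\<close> monotone. For any other set, possibly infinite, both sides are
      zero.\<close>
    proof (cases "insert m \<tau> \<in> Poly_Mapping.keys c")
      case True
      then have "finite (insert m \<tau>)" using c M by (meson PowD finite_subset subsetD)
      then have le: "Sup \<tau> \<subseteq># Sup (insert m \<tau>)"
        by (rule Sup_multiset_mono) blast
      then have sum: "Sup (insert m \<tau>) = Sup \<tau> + (Sup (insert m \<tau>) - Sup \<tau>)" by simp
      show ?thesis
      proof (cases "Sup \<tau> \<subseteq># v")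
        case True
        then have v: "v = Sup \<tau> + (v - Sup \<tau>)" by simp
        have "Sup (insert m \<tau>) - Sup \<tau> \<subseteq># v - Sup \<tau> \<longleftrightarrow> Sup (insert m \<tau>) \<subseteq># v"
          by (subst (2) sum, subst (2) v) (rule subset_mset.add_le_cancel_left[symmetric])
        moreover have "v - Sup \<tau> - (Sup (insert m \<tau>) - Sup \<tau>) = v - Sup (insert m \<tau>)"
          by (metis diff_diff_add_mset sum)
        ultimately show ?thesis using True by (simp add: graded_coeff_def)
      next
        case False
        then have "\<not> Sup (insert m \<tau>) \<subseteq># v" using le by (meson subset_mset.order_trans)
        then show ?thesis using False by (simp add: graded_coeff_def)
      qed
    qed (simp add: graded_coeff_def in_keys_iff)
  qed
  finally show ?thesis .
qed

text \<open>Used both to move a single homogeneous component to another multidegree and to glue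
  preimages found separately. Finiteness of \<open>Vs\<close> and \<open>S\<close> ensures finite
  support.\<close>

lemma chain_with_graded_coeffs:
  fixes a :: "'v multiset \<Rightarrow> 'v multiset set \<Rightarrow> 'k::field"
  assumes Vs: "finite Vs" and S: "finite S"
    and a: "\<And>v \<sigma>. v \<in> Vs \<Longrightarrow> a v \<sigma> \<noteq> 0 \<Longrightarrow> \<sigma> \<in> S \<and> Sup \<sigma> \<subseteq># v"
  obtains b where "\<And>v \<sigma>. graded_coeff b v \<sigma> = (if v \<in> Vs then a v \<sigma> else 0)"
proof
  let ?b = "\<Sum>v\<in>Vs. \<Sum>\<sigma>\<in>S. Poly_Mapping.single \<sigma> (Poly_Mapping.single (v - Sup \<sigma>) (a v \<sigma>))"
  fix u \<tau>
  have "Poly_Mapping.lookup ?b \<tau> = (\<Sum>v\<in>Vs. Poly_Mapping.single (v - Sup \<tau>) (a v \<tau>))"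
    unfolding lookup_sum
  proof (rule sum.cong[OF refl])
    fix v assume v: "v \<in> Vs"
    have "(\<Sum>\<sigma>\<in>S. Poly_Mapping.lookup (Poly_Mapping.single \<sigma> (Poly_Mapping.single (v - Sup \<sigma>) (a v \<sigma>))) \<tau>)
        = (if \<tau> \<in> S then Poly_Mapping.single (v - Sup \<tau>) (a v \<tau>) else 0)"
      using S by (simp add: lookup_single when_def)
    also have "\<dots> = Poly_Mapping.single (v - Sup \<tau>) (a v \<tau>)"
      using a[OF v, of \<tau>] by (cases "a v \<tau> = 0") auto
    finally show "(\<Sum>\<sigma>\<in>S. Poly_Mapping.lookup (Poly_Mapping.single \<sigma> (Poly_Mapping.single (v - Sup \<sigma>) (a v \<sigma>))) \<tau>)
        = Poly_Mapping.single (v - Sup \<tau>) (a v \<tau>)" .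
  qed
  then have b: "Poly_Mapping.lookup (Poly_Mapping.lookup ?b \<tau>) w
      = (\<Sum>v\<in>Vs. if v - Sup \<tau> = w then a v \<tau> else 0)" for w
    by (simp add: lookup_sum lookup_single when_def)
  show "graded_coeff ?b u \<tau> = (if u \<in> Vs then a u \<tau> else 0)"
  proof (cases "Sup \<tau> \<subseteq># u")
    case True
    \<comment> \<open>Multiset difference truncates, so \<open>v - Sup \<tau>\<close> determines
      \<open>v\<close> only when \<open>Sup \<tau>\<close> divides \<open>v\<close>; this is
      guaranteed wherever \<open>a v \<tau>\<close> is nonzero.\<close>
    have "(\<Sum>v\<in>Vs. if v - Sup \<tau> = u - Sup \<tau> then a v \<tau> else 0) = (\<Sum>v\<in>Vs. if v = u then a u \<tau> else 0)"
    proof (rule sum.cong[OF refl])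
      fix v assume v: "v \<in> Vs"
      show "(if v - Sup \<tau> = u - Sup \<tau> then a v \<tau> else 0) = (if v = u then a u \<tau> else 0)"
      proof (cases "a v \<tau> = 0")
        case False
        then have "Sup \<tau> \<subseteq># v" using a v by blast
        then have "v - Sup \<tau> = u - Sup \<tau> \<longleftrightarrow> v = u"
          using True by (metis subset_mset.diff_add)
        then show ?thesis by simp
      qed auto
    qed
    then show ?thesis using True Vs by (simp add: graded_coeff_def b)
  next
    case False
    then show ?thesis using a[of u \<tau>] by (auto simp: graded_coeff_def)
  qed
qed

lemma finite_multidegrees: "finite {v. \<exists>\<sigma>. graded_coeff c v \<sigma> \<noteq> 0}"
proof (rule finite_subset)
  show "{v. \<exists>\<sigma>. graded_coeff c v \<sigma> \<noteq> 0}
      \<subseteq> (\<Union>\<sigma>\<in>Poly_Mapping.keys c. (\<lambda>w. w + Sup \<sigma>) ` Poly_Mapping.keys (Poly_Mapping.lookup c \<sigma>))"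
  proof safe
    fix v \<sigma> assume nz: "graded_coeff c v \<sigma> \<noteq> 0"
    have "v = (v - Sup \<sigma>) + Sup \<sigma>" using graded_coeff_nonzeroD(1)[OF nz] by simp
    then show "v \<in> (\<Union>\<sigma>\<in>Poly_Mapping.keys c. (\<lambda>w. w + Sup \<sigma>) ` Poly_Mapping.keys (Poly_Mapping.lookup c \<sigma>))"
      using graded_coeff_nonzeroD(2,3)[OF nz] by blast
  qed
qed auto

section \<open>Scarf chains of a finitely generated monomial ideal\<close>

lemma minimal_monomial_generating_set_antichainD:
  fixes I :: "('v, 'k::field) polynomial set"
  assumes M: "minimal_monomial_generating_set V I M"
    and uw: "u \<in> M" "w \<in> M" "u \<subseteq># w"
  shows "u = w"
proof (rule ccontr)
  assume ne: "u \<noteq> w"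
  have V: "\<forall>u\<in>M. set_mset u \<subseteq> V" and I: "genideal (poly_ring V) (monomial ` M) = I"
    and min: "\<And>N. N \<subset> M \<Longrightarrow> genideal (poly_ring V) (monomial ` N) \<noteq> I"
    using M by (auto simp: minimal_monomial_generating_set_def)
  have "(\<exists>x\<in>M. x \<subseteq># y) \<longleftrightarrow> (\<exists>x\<in>M - {w}. x \<subseteq># y)" for y
  proof
    assume "\<exists>x\<in>M. x \<subseteq># y"
    then obtain x where x: "x \<in> M" "x \<subseteq># y" by blast
    have "u \<subseteq># y" if "x = w" using that x uw by (meson subset_mset.order_trans)
    then show "\<exists>x\<in>M - {w}. x \<subseteq># y" using x uw ne by blast
  qed blast
  then have "{y. \<exists>x\<in>M - {w}. x \<subseteq># y} = {y. \<exists>x\<in>M. x \<subseteq># y}" by simp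
  moreover have "\<forall>u\<in>M - {w}. set_mset u \<subseteq> V" using V by blast
  ultimately have "genideal (poly_ring V) (monomial ` (M - {w})) = I"
    using I genideal_monomials[OF V, where 'k = 'k]
      genideal_monomials[of "M - {w}" V, where 'k = 'k] by simp
  then show False using min[of "M - {w}"] uw by blast
qed

text \<open>Used for the ideal and again for its restriction; fixing \<open>M\<close> replaces the
  definite description in \<open>mingens\<close>.\<close>

locale finite_monomial_generators =
  fixes V :: "'v set" and I :: "('v, 'k::field) polynomial set" and M :: "'v multiset set"
  assumes generators: "minimal_monomial_generating_set V I M" and finite_generators: "finite M"
begin

lemma mingens_M: "mingens V I = M"
  by (rule mingens_eq[OF generators])

lemma generators_in_V: "u \<in> M \<Longrightarrow> set_mset u \<subseteq> V"
  using generators by (simp add: minimal_monomial_generating_set_def)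

lemma ideal_eq: "I = monomial_span V {w. \<exists>u\<in>M. u \<subseteq># w}"
proof -
  have "genideal (poly_ring V) (monomial ` M) = I"
    using generators by (simp add: minimal_monomial_generating_set_def)
  then show ?thesis using genideal_monomials[of M V, where 'k = 'k] generators_in_V by simp
qed

lemma finite_face: "\<sigma> \<in> scarf_complex V I \<Longrightarrow> finite \<sigma>"
  using finite_generators finite_subset by (auto simp: scarf_complex_def mingens_M)

lemma faces_subset: "scarf_complex V I \<subseteq> Pow M"
  by (auto simp: scarf_complex_def mingens_M)

lemma set_mset_Sup_face:
  assumes "\<sigma> \<in> scarf_complex V I"
  shows "set_mset (Sup \<sigma>) \<subseteq> V"
proof
  fix x assume "x \<in># Sup \<sigma>"
  then obtain m where "m \<in> \<sigma>" "x \<in># m" using in_Sup_multisetD by metis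
  then show "x \<in> V" using assms faces_subset generators_in_V by blast
qed

text \<open>Labels of faces involve only variables in \<open>V\<close>, so asking that the
  coefficients lie in the ring amounts to asking that the occurring multidegrees be supported on
  \<open>V\<close>. Membership can thus be tested componentwise.\<close>

lemma scarf_chains_iff:
  "c \<in> scarf_chains V I d \<longleftrightarrow>
     (\<forall>v \<sigma>. graded_coeff c v \<sigma> \<noteq> 0 \<longrightarrow> \<sigma> \<in> scarf_complex V I \<and> card \<sigma> = d \<and> set_mset v \<subseteq> V)"
    (is "_ \<longleftrightarrow> ?R")
proof
  assume c: "c \<in> scarf_chains V I d"
  show ?R
  proof (intro allI impI)
    fix v \<sigma> assume nz: "graded_coeff c v \<sigma> \<noteq> 0"
    note * = graded_coeff_nonzeroD[OF nz]
    have \<sigma>: "\<sigma> \<in> scarf_complex V I" "card \<sigma> = d"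
      using c *(3) by (auto simp: scarf_chains_def)
    have "set_mset (v - Sup \<sigma>) \<subseteq> V"
      using c *(2) by (auto simp: scarf_chains_def carrier_poly_ring)
    moreover have "set_mset v = set_mset (v - Sup \<sigma>) \<union> set_mset (Sup \<sigma>)"
      using *(1) by (metis set_mset_union subset_mset.diff_add)
    ultimately show "\<sigma> \<in> scarf_complex V I \<and> card \<sigma> = d \<and> set_mset v \<subseteq> V"
      using \<sigma> set_mset_Sup_face by blast
  qed
next
  assume R: ?R
  have *: "\<sigma> \<in> scarf_complex V I \<and> card \<sigma> = d \<and> set_mset w \<subseteq> V"
    if "w \<in> Poly_Mapping.keys (Poly_Mapping.lookup c \<sigma>)" for w \<sigma>
    using R[rule_format, of "w + Sup \<sigma>" \<sigma>] that by (simp add: in_keys_iff)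
  have "\<sigma> \<in> scarf_complex V I \<and> card \<sigma> = d" if "\<sigma> \<in> Poly_Mapping.keys c" for \<sigma>
  proof -
    have "Poly_Mapping.keys (Poly_Mapping.lookup c \<sigma>) \<noteq> {}"
      using that by (simp add: in_keys_iff)
    then show ?thesis using * by blast
  qed
  then show "c \<in> scarf_chains V I d"
    using * by (auto simp: scarf_chains_def carrier_poly_ring)
qed

lemma scarf_chains_keys: "c \<in> scarf_chains V I d \<Longrightarrow> Poly_Mapping.keys c \<subseteq> Pow M"
  using faces_subset by (auto simp: scarf_chains_def)

lemma graded_coeff_differential:
  "c \<in> scarf_chains V I d \<Longrightarrow>
     graded_coeff (taylor_differential idx c) v \<tau> = boundary idx M (graded_coeff c v) \<tau>"
  by (rule graded_coeff_taylor_differential[OF finite_generators scarf_chains_keys])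

lemma graded_coeff_differential_nonzeroD:
  assumes "c \<in> scarf_chains V I d" "graded_coeff (taylor_differential idx c) v \<tau> \<noteq> 0"
  obtains m where "m \<in> M" "m \<notin> \<tau>" "graded_coeff c v (insert m \<tau>) \<noteq> 0"
  using assms graded_coeff_differential[OF assms(1)]
  unfolding boundary_def by (metis (no_types, lifting) DiffE mult_zero_right sum.neutral)

end

section \<open>Restriction to the generators dividing a monomial\<close>

locale restricted_generators = finite_monomial_generators V I M
  for V :: "'v set" and I :: "('v, 'k::field) polynomial set" and M +
  fixes u :: "'v multiset"
begin

abbreviation "J \<equiv> restrict_below V I u"

abbreviation "N \<equiv> {w \<in> M. w \<subseteq># u}"

sublocale restr: finite_monomial_generators V J N
proof
  show "finite N" using finite_generators by simp
  show "minimal_monomial_generating_set V J N"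
    unfolding restrict_below_def mingens_M
    by (rule minimal_monomial_generating_set_antichain)
      (use generators_in_V minimal_monomial_generating_set_antichainD[OF generators] in auto)
qed

lemma subset_N_iff: "\<sigma> \<subseteq> M \<Longrightarrow> \<sigma> \<subseteq> N \<longleftrightarrow> Sup \<sigma> \<subseteq># u"
  using finite_generators finite_subset by (subst Sup_multiset_le_iff) auto

text \<open>By \<open>subset_N_iff\<close>, whether a subset of \<open>M\<close> lies in
  \<open>N\<close> depends only on its label. Any competitor with the same label as a subset of
  \<open>N\<close> therefore lies in \<open>N\<close> as well.\<close>

lemma scarf_complex_restrict: "scarf_complex V J = {\<sigma> \<in> scarf_complex V I. \<sigma> \<subseteq> N}"
proof (intro equalityI subsetI)
  fix \<sigma> assume "\<sigma> \<in> scarf_complex V J"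
  then have \<sigma>: "\<sigma> \<subseteq> N" "\<And>\<tau>. \<tau> \<subseteq> N \<Longrightarrow> \<tau> \<noteq> \<sigma> \<Longrightarrow> Sup \<sigma> \<noteq> Sup \<tau>"
    by (simp_all add: scarf_complex_def restr.mingens_M)
  have "\<sigma> \<subseteq> M" using \<sigma>(1) by blast
  moreover have "Sup \<sigma> \<noteq> Sup \<tau>" if "\<tau> \<subseteq> M" "\<tau> \<noteq> \<sigma>" for \<tau>
    using \<sigma> that \<open>\<sigma> \<subseteq> M\<close> subset_N_iff[of \<sigma>] subset_N_iff[of \<tau>] by metis
  ultimately show "\<sigma> \<in> {\<sigma> \<in> scarf_complex V I. \<sigma> \<subseteq> N}"
    using \<sigma>(1) by (simp add: scarf_complex_def mingens_M)
next
  fix \<sigma> assume "\<sigma> \<in> {\<sigma> \<in> scarf_complex V I. \<sigma> \<subseteq> N}"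
  then show "\<sigma> \<in> scarf_complex V J"
    by (auto simp: scarf_complex_def mingens_M restr.mingens_M)
qed

lemma scarf_chains_restrict:
  "c \<in> scarf_chains V J d \<longleftrightarrow>
     c \<in> scarf_chains V I d \<and> (\<forall>v \<sigma>. graded_coeff c v \<sigma> \<noteq> 0 \<longrightarrow> \<sigma> \<subseteq> N)"
  unfolding restr.scarf_chains_iff scarf_chains_iff scarf_complex_restrict by blast

text \<open>
  In multidegree \<open>v\<close>, the restricted complex coincides with the unrestricted one in multidegree
  \<open>v \<inter># u\<close>, so preimages may be found there.
\<close>

lemma preimage_restrict:
  assumes c: "c \<in> scarf_chains V J d"
    and pre: "\<And>v e. \<lbrakk>e \<in> scarf_chains V I d; \<exists>\<sigma>. graded_coeff c v \<sigma> \<noteq> 0;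
        \<And>h \<sigma>. graded_coeff e h \<sigma> = (if h = v \<inter># u then graded_coeff c v \<sigma> else 0)\<rbrakk>
        \<Longrightarrow> e \<in> taylor_differential idx ` scarf_chains V I (Suc d)"
  shows "c \<in> taylor_differential idx ` scarf_chains V J (Suc d)"
proof -
  define Vs where "Vs = {v. \<exists>\<sigma>. graded_coeff c v \<sigma> \<noteq> 0}"
  have cI: "c \<in> scarf_chains V I d" using c by (simp add: scarf_chains_restrict)
  note cD = cI[unfolded scarf_chains_iff, rule_format]
  have "\<exists>b\<in>scarf_chains V I (Suc d).
      \<forall>\<tau>. boundary idx M (graded_coeff b (v \<inter># u)) \<tau> = graded_coeff c v \<tau>" if v: "v \<in> Vs" for v
  proof -
    have le: "Sup \<sigma> \<subseteq># v \<inter># u" if nz: "graded_coeff c v \<sigma> \<noteq> 0" for \<sigma>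
    proof -
      have "\<sigma> \<subseteq> N" using c nz by (auto simp: scarf_chains_restrict)
      then have "Sup \<sigma> \<subseteq># u" using subset_N_iff[of \<sigma>] by blast
      then show ?thesis using graded_coeff_nonzeroD(1)[OF nz] by simp
    qed
    \<comment> \<open>\<open>e\<close> carries the component of \<open>c\<close> in multidegree
      \<open>v\<close> over to \<open>v \<inter># u\<close>, with unchanged coefficients;
      \<open>le\<close> says that the labels allow this.\<close>
    obtain e where e: "\<And>h \<sigma>. graded_coeff e h \<sigma> = (if h \<in> {v \<inter># u} then graded_coeff c v \<sigma> else 0)"
      using chain_with_graded_coeffs[of "{v \<inter># u}" "Poly_Mapping.keys c" "\<lambda>h. graded_coeff c v"]
        graded_coeff_nonzeroD(3) le by (metis (no_types, lifting) finite.emptyI finite.insertI finite_keys singletonD)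
    have eI: "e \<in> scarf_chains V I d"
      unfolding scarf_chains_iff
    proof (intro allI impI)
      fix h \<sigma> assume "graded_coeff e h \<sigma> \<noteq> 0"
      then have "h = v \<inter># u" "graded_coeff c v \<sigma> \<noteq> 0" by (auto simp: e split: if_splits)
      then show "\<sigma> \<in> scarf_complex V I \<and> card \<sigma> = d \<and> set_mset h \<subseteq> V"
        using cD by fastforce
    qed
    then have "e \<in> taylor_differential idx ` scarf_chains V I (Suc d)"
      using v e by (intro pre) (auto simp: Vs_def)
    then obtain b where b: "b \<in> scarf_chains V I (Suc d)" "e = taylor_differential idx b" by blast
    have "boundary idx M (graded_coeff b (v \<inter># u)) \<tau> = graded_coeff c v \<tau>" for \<tau>
      using e[of "v \<inter># u" \<tau>] b graded_coeff_differential[OF b(1), of idx "v \<inter># u" \<tau>] by simp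
    then show ?thesis using b by blast
  qed
  then obtain b where bI: "\<And>v. v \<in> Vs \<Longrightarrow> b v \<in> scarf_chains V I (Suc d)"
    and b: "\<And>v \<tau>. v \<in> Vs \<Longrightarrow> boundary idx M (graded_coeff (b v) (v \<inter># u)) \<tau> = graded_coeff c v \<tau>"
    by metis
  \<comment> \<open>Only the component of the preimage in multidegree \<open>v \<inter># u\<close>
    is kept. Its faces have labels dividing \<open>u\<close>, hence lie in \<open>N\<close>, and it
    can be placed back in multidegree \<open>v\<close>.\<close>
  define a where "a v = graded_coeff (b v) (v \<inter># u)" for v
  have a: "\<sigma> \<in> scarf_complex V I \<and> card \<sigma> = Suc d \<and> \<sigma> \<subseteq> N \<and> Sup \<sigma> \<subseteq># v"
    if "v \<in> Vs" "a v \<sigma> \<noteq> 0" for v \<sigma>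
  proof -
    have nz: "graded_coeff (b v) (v \<inter># u) \<sigma> \<noteq> 0" using that by (simp add: a_def)
    have *: "\<sigma> \<in> scarf_complex V I" "card \<sigma> = Suc d"
      using bI[OF that(1)] nz unfolding scarf_chains_iff by blast+
    have le: "Sup \<sigma> \<subseteq># v" "Sup \<sigma> \<subseteq># u" using graded_coeff_nonzeroD(1)[OF nz] by simp_all
    then show ?thesis using * subset_N_iff[of \<sigma>] faces_subset by blast
  qed
  have Vs: "finite Vs" unfolding Vs_def by (rule finite_multidegrees)
  have "finite (Pow M)" using finite_generators by simp
  \<comment> \<open>The components are glued with indices \<open>v\<close>, not
    \<open>v \<inter># u\<close>, since different \<open>v\<close> may have the same gcd with
    \<open>u\<close>.\<close>
  then obtain B where B: "\<And>v \<sigma>. graded_coeff B v \<sigma> = (if v \<in> Vs then a v \<sigma> else 0)"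
    using chain_with_graded_coeffs[OF Vs, of "Pow M" a] a faces_subset by (metis subsetD)
  have BJ: "B \<in> scarf_chains V J (Suc d)"
    unfolding restr.scarf_chains_iff scarf_complex_restrict
  proof (intro allI impI)
    fix v \<sigma> assume "graded_coeff B v \<sigma> \<noteq> 0"
    then have v: "v \<in> Vs" "a v \<sigma> \<noteq> 0" by (auto simp: B split: if_splits)
    then have "set_mset v \<subseteq> V" using cD unfolding Vs_def by blast
    then show "\<sigma> \<in> {\<sigma> \<in> scarf_complex V I. \<sigma> \<subseteq> N} \<and> card \<sigma> = Suc d \<and> set_mset v \<subseteq> V"
      using a[OF v] by blast
  qed
  then have BI: "B \<in> scarf_chains V I (Suc d)" by (simp add: scarf_chains_restrict)
  have "taylor_differential idx B = c"
  proof (rule chain_eqI)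
    fix v \<tau>
    show "graded_coeff (taylor_differential idx B) v \<tau> = graded_coeff c v \<tau>"
    proof (cases "v \<in> Vs")
      case True
      then have "graded_coeff B v = a v" using B by auto
      then show ?thesis using b[OF True] by (simp add: graded_coeff_differential[OF BI] a_def)
    next
      case False
      then have "graded_coeff B v = (\<lambda>_. 0)" using B by auto
      then show ?thesis using False by (simp add: graded_coeff_differential[OF BI] boundary_def Vs_def)
    qed
  qed
  then show ?thesis using BJ by blast
qed

text \<open>Chains of the restriction are chains of the full complex, which yields the subcomplex
  property and minimality. Exactness in degree 0 and in positive degrees follows from
  \<open>preimage_restrict\<close>, whose hypothesis is met by the augmentation condition or the
  cycle condition respectively.\<close>

lemma scarf_restrict:
  assumes "scarf_is_minimal_free_resolution idx V I"
  shows "scarf_is_minimal_free_resolution idx V J"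
proof -
  let ?D = "taylor_differential idx" and ?F = "scarf_chains V I" and ?G = "scarf_chains V J"
  have sub: "?D ` ?F (Suc d) \<subseteq> ?F d"
    and aug: "?D ` ?F 1 = {c \<in> ?F 0. Poly_Mapping.lookup c {} \<in> I}"
    and exact: "d \<ge> 1 \<Longrightarrow> ?D ` ?F (Suc d) = {c \<in> ?F d. ?D c = 0}"
    and minimal: "c \<in> ?F (Suc d) \<Longrightarrow> Poly_Mapping.lookup (?D c) \<tau> \<in> var_ideal V V"
    for d c \<tau>
    using assms unfolding scarf_is_minimal_free_resolution_def Let_def
    by (elim conjE; elim allE[where x = d]; simp)+
  have GF: "c \<in> ?F d" if "c \<in> ?G d" for c d
    using that by (simp add: scarf_chains_restrict)
  have subG: "?D c \<in> ?G d" if c: "c \<in> ?G (Suc d)" for c d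
    unfolding scarf_chains_restrict
  proof (intro conjI allI impI)
    show "?D c \<in> ?F d" using sub GF[OF c] by blast
    fix v \<sigma> assume "graded_coeff (?D c) v \<sigma> \<noteq> 0"
    then obtain m where "graded_coeff c v (insert m \<sigma>) \<noteq> 0"
      using graded_coeff_differential_nonzeroD[OF GF[OF c]] by blast
    then show "\<sigma> \<subseteq> N" using c unfolding scarf_chains_restrict by blast
  qed
  have lookup_empty: "Poly_Mapping.lookup (Poly_Mapping.lookup c {}) w = graded_coeff c w {}" for c w
    by (simp add: graded_coeff_def Sup_multiset_empty)
  have aug_onto: "\<exists>c\<in>?G 0. p - Poly_Mapping.lookup c {} \<in> J" if p: "p \<in> carrier (poly_ring V)" for p
  proof (cases "{#} \<in> N")
    case True
    \<comment> \<open>If 1 is a generator, then \<open>J\<close> is the whole ring and the zero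
      chain suffices.\<close>
    then have "p \<in> J" using p unfolding restr.ideal_eq monomial_span_def by auto
    then show ?thesis by (intro bexI[of _ 0]) (auto simp: scarf_chains_def carrier_poly_ring)
  next
    case False
    \<comment> \<open>When 1 is not a generator, only the empty set has label 1, so the empty face
      is available to carry \<open>p\<close>.\<close>
    have "{} \<in> scarf_complex V J"
      unfolding scarf_complex_def restr.mingens_M
    proof (intro CollectI conjI allI impI notI, goal_cases)
      case (2 \<tau>)
      then have "finite \<tau>" using restr.finite_generators finite_subset by blast
      moreover have "Sup \<tau> \<subseteq># {#}" using 2 by (simp add: Sup_multiset_empty)
      ultimately have "\<forall>m\<in>\<tau>. m \<subseteq># {#}" by (rule iffD1[OF Sup_multiset_le_iff])
      moreover obtain m where "m \<in> \<tau>" using 2 by auto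
      ultimately have "{#} \<in> \<tau>" by auto
      then show False using 2 False by (meson subsetD)
    qed simp
    moreover have "0 \<in> J" unfolding restr.ideal_eq by (simp add: monomial_span_def carrier_poly_ring)
    ultimately show ?thesis using p
      by (intro bexI[of _ "Poly_Mapping.single {} p"])
        (auto simp: scarf_chains_def lookup_single when_def carrier_poly_ring)
  qed
  have augG: "?D ` ?G 1 = {c \<in> ?G 0. Poly_Mapping.lookup c {} \<in> J}"
  proof (intro equalityI subsetI)
    fix c assume "c \<in> ?D ` ?G 1"
    then obtain b where b: "b \<in> ?G 1" "c = ?D b" by blast
    have c: "c \<in> ?G 0" using subG[of b 0] b by simp
    have "\<exists>m\<in>N. m \<subseteq># w" if "w \<in> Poly_Mapping.keys (Poly_Mapping.lookup c {})" for w
    proof -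
      \<comment> \<open>A term of multidegree \<open>w\<close> at the empty face comes from a vertex
        \<open>{m}\<close> with \<open>m\<close> dividing \<open>w\<close>, and \<open>m\<close> is
        in \<open>N\<close>.\<close>
      have "graded_coeff (?D b) w {} \<noteq> 0" using that by (simp add: b lookup_empty in_keys_iff)
      then obtain m where m: "graded_coeff b w {m} \<noteq> 0"
        using graded_coeff_differential_nonzeroD[OF GF[OF b(1)]] by metis
      then have "{m} \<subseteq> N" using b unfolding scarf_chains_restrict by blast
      then show ?thesis using graded_coeff_nonzeroD(1)[OF m] by (auto simp: Sup_multiset_le_iff)
    qed
    moreover have "Poly_Mapping.lookup c {} \<in> carrier (poly_ring V)"
      using c by (simp add: scarf_chains_def)
    ultimately show "c \<in> {c \<in> ?G 0. Poly_Mapping.lookup c {} \<in> J}"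
      using c unfolding restr.ideal_eq monomial_span_def by blast
  next
    fix c assume "c \<in> {c \<in> ?G 0. Poly_Mapping.lookup c {} \<in> J}"
    then have c: "c \<in> ?G 0" "Poly_Mapping.lookup c {} \<in> J" by auto
    have "c \<in> ?D ` ?G (Suc 0)"
    proof (rule preimage_restrict[OF c(1)])
      fix v e assume e: "e \<in> ?F 0" "\<exists>\<sigma>. graded_coeff c v \<sigma> \<noteq> 0"
        "\<And>h \<sigma>. graded_coeff e h \<sigma> = (if h = v \<inter># u then graded_coeff c v \<sigma> else 0)"
      obtain \<sigma> where \<sigma>: "graded_coeff c v \<sigma> \<noteq> 0" using e by blast
      then have "card \<sigma> = 0" "\<sigma> \<in> scarf_complex V J"
        using c(1) unfolding restr.scarf_chains_iff by blast+
      then have "\<sigma> = {}" using restr.finite_face by auto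
      then have "v \<in> Poly_Mapping.keys (Poly_Mapping.lookup c {})"
        using \<sigma> by (simp add: lookup_empty in_keys_iff)
      \<comment> \<open>A generator in \<open>N\<close> dividing \<open>v\<close> also divides
        \<open>v \<inter># u\<close>; hence the shifted coefficient lies in
        \<open>I\<close>.\<close>
      then obtain m where m: "m \<in> N" "m \<subseteq># v"
        using c(2) unfolding restr.ideal_eq monomial_span_def by blast
      have "w = v \<inter># u" if "w \<in> Poly_Mapping.keys (Poly_Mapping.lookup e {})" for w
        using that e(3)[of w "{}"] by (auto simp: in_keys_iff lookup_empty split: if_splits)
      then have "\<exists>m\<in>M. m \<subseteq># w" if "w \<in> Poly_Mapping.keys (Poly_Mapping.lookup e {})" for w
        using that m by (metis (mono_tags, lifting) mem_Collect_eq subset_mset.inf_greatest)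
      moreover have "Poly_Mapping.lookup e {} \<in> carrier (poly_ring V)"
        using e(1) by (simp add: scarf_chains_def)
      ultimately have "Poly_Mapping.lookup e {} \<in> I"
        unfolding ideal_eq monomial_span_def by blast
      then show "e \<in> ?D ` ?F (Suc 0)" using aug e(1) by auto
    qed
    then show "c \<in> ?D ` ?G 1" by simp
  qed
  have exactG: "?D ` ?G (Suc d) = {c \<in> ?G d. ?D c = 0}" if d: "d \<ge> 1" for d
  proof (intro equalityI subsetI)
    fix c assume "c \<in> ?D ` ?G (Suc d)"
    then show "c \<in> {c \<in> ?G d. ?D c = 0}"
      using subG GF exact[OF d] by blast
  next
    fix c assume "c \<in> {c \<in> ?G d. ?D c = 0}"
    then have c: "c \<in> ?G d" "?D c = 0" by auto
    show "c \<in> ?D ` ?G (Suc d)"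
    proof (rule preimage_restrict[OF c(1)])
      fix v e assume e: "e \<in> ?F d"
        "\<And>h \<sigma>. graded_coeff e h \<sigma> = (if h = v \<inter># u then graded_coeff c v \<sigma> else 0)"
      have "?D e = 0"
      proof (rule chain_eqI)
        fix h \<tau>
        \<comment> \<open>Each component of a cycle is a cycle for \<open>boundary\<close>, and
          remains one after the move to \<open>v \<inter># u\<close>.\<close>
        have "boundary idx M (graded_coeff c v) \<tau> = 0"
          using graded_coeff_differential[OF GF[OF c(1)], of idx v \<tau>] c(2) by simp
        then show "graded_coeff (?D e) h \<tau> = graded_coeff 0 h \<tau>"
          unfolding graded_coeff_differential[OF e(1)] by (cases "h = v \<inter># u") (simp_all add: boundary_def e(2))
      qed
      then show "e \<in> ?D ` ?F (Suc d)" using exact[OF d] e(1) by blast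
    qed
  qed
  show ?thesis
    unfolding scarf_is_minimal_free_resolution_def Let_def
  proof (intro conjI allI ballI impI)
    show "?D ` ?G (Suc d) \<subseteq> ?G d" for d using subG by blast
    show "Poly_Mapping.lookup (?D c) \<tau> \<in> var_ideal V V" if "c \<in> ?G (Suc d)" for d c \<tau>
      using minimal[OF GF[OF that]] .
  qed (rule aug_onto augG exactG, assumption?)+
qed

lemma is_Scarf_restrict: "is_Scarf V I \<Longrightarrow> is_Scarf V J"
  unfolding is_Scarf_def mingens_M restr.mingens_M
  using scarf_restrict by (blast intro: inj_on_subset)

end

theorem theorem4p7:
  fixes G H :: "'v graph" and n :: nat
  assumes "finite_simple_graph G"
    and "no_isolated_vertices G"
    and "induced_subgraph_of H G"
    and "n > 0"
  shows "restrict_below (verts G)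
           (edge_ideal_symbolic_power (verts G) G n :: ('v, 'k::field) polynomial set)
           (repeat_mset n (mset_set (verts H)))
         = edge_ideal_symbolic_power (verts G) H n \<and>
         (is_Scarf (verts G) (edge_ideal_symbolic_power (verts G) G n :: ('v, 'k) polynomial set)
          \<longrightarrow> is_Scarf (verts G) (edge_ideal_symbolic_power (verts G) H n :: ('v, 'k) polynomial set))"
proof
  let ?V = "verts G" and ?u = "repeat_mset n (mset_set (verts H))"
  let ?I = "edge_ideal_symbolic_power ?V G n :: ('v, 'k) polynomial set"
  let ?M = "\<lambda>K. minimal_elements {w \<in> symbolic_power_monomials K n. set_mset w \<subseteq> ?V}"
  have HG: "verts H \<subseteq> ?V" and H: "finite_simple_graph H"
    using assms finite_simple_graph_induced by (auto simp: induced_subgraph_of_def)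
  \<comment> \<open>Stated for a general \<open>K\<close> because it is applied to both
    \<open>G\<close> and \<open>H\<close>, over the same ring in the variables of
    \<open>G\<close>.\<close>
  have gen: "minimal_monomial_generating_set ?V
      (edge_ideal_symbolic_power ?V K n :: ('v, 'k) polynomial set) (?M K)"
    if "finite_simple_graph K" "verts K \<subseteq> ?V" for K :: "'v graph"
    unfolding edge_ideal_symbolic_power_eq[OF that]
    by (rule minimal_monomial_generating_set_minimal_elements[OF upward_closed_symbolic_power_monomials])
  have "?M G \<subseteq> {w. w \<subseteq># repeat_mset n (mset_set (verts G))}"
    using minimal_elements_symbolic_power_le[OF assms(1)] by blast
  then have "finite (?M G)" by (rule finite_subset) (rule finite_multisets_below)
  then interpret restricted_generators ?V ?I "?M G" ?u
    by unfold_locales (rule gen[OF assms(1) subset_refl])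
  \<comment> \<open>The generators of the symbolic power of \<open>G\<close> selected by
    \<open>?u\<close> are precisely \<open>?M H\<close>, so the restriction is the ideal generated
    by \<open>?M H\<close>.\<close>
  have "genideal (poly_ring ?V) (monomial ` ?M H)
      = (edge_ideal_symbolic_power ?V H n :: ('v, 'k) polynomial set)"
    using gen[OF H HG] by (simp add: minimal_monomial_generating_set_def)
  then show eq: "J = edge_ideal_symbolic_power ?V H n"
    unfolding restrict_below_def mingens_M minimal_elements_symbolic_power_induced[OF assms(1,3)] .
  show "is_Scarf ?V ?I \<longrightarrow> is_Scarf ?V (edge_ideal_symbolic_power ?V H n :: ('v, 'k) polynomial set)"
    using is_Scarf_restrict unfolding eq by blast
qed

end
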